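(* Every simple theory is rosy. Moreover, in a simple theory, for any sets $A,B,C$, if $A$ is forking-independent from $B$ over $C$, then $A\perp^{þ}_C B$.
   Context: $T$ is a complete first-order theory with monster model $\mathcal C$ (saturated, of large cardinality); all sets, tuples, types and models are small and live inside $\mathcal C$. One works in $\mathcal C^{eq}$. A family $\{\delta(x,a')\}_{a'\in S}$ is $k$-inconsistent if $\bigwedge_{i=1}^k\delta(x,a_i)$ is inconsistent for all pairwise distinct $a_1,\dots,a_k\in S$. A formula $\delta(x,a)$ strongly divides over $A$ if $tp(a/A)$ is non-algebraic and $\{\delta(x,a')\}_{a'\models tp(a/A)}$ is $k$-inconsistent for some $k\in\mathbb N$. It þ-divides over $A$ if there is a tuple $c$ such that $\delta(x,a)$ strongly divides over $Ac$. A formula þ-forks over $A$ if it implies a finite disjunction of formulas (with parameters) each of which þ-divides over $A$. A type þ-forks over $A$ if it contains a formula which þ-forks over $A$. $A\perp^{þ}_C B$ means that the type of (an enumeration of) $A$ over $BC$ does not þ-fork over $C$. þ-rank: for a formula $\phi$ (with parameters) in $x$, a set $\Delta$ of parameter-free formulas in variables $x;y$, a set $\Pi$ of parameter-free formulas in variables $y;z$ ($z$ possibly of infinite length), and $k\in\mathbb N$, define þ$(\phi,\Delta,\Pi,k)$ inductively: (1) þ$(\phi,\Delta,\Pi,k)\ge 0$ if $\phi$ is consistent; (2) for $\lambda$ a limit ordinal, þ$(\phi,\Delta,\Pi,k)\ge\lambda$ iff þ$(\phi,\Delta,\Pi,k)\ge\alpha$ for all $\alpha<\lambda$; (3) þ$(\phi,\Delta,\Pi,k)\ge\alpha+1$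 iff there are $\delta\in\Delta$, $\pi(y;z)\in\Pi$ and parameters $c$ such that þ$(\phi\wedge\delta(x,a),\Delta,\Pi,k)\ge\alpha$ for infinitely many $a\models\pi(y;c)$, and $\{\delta(x,a)\}_{a\models\pi(y;c)}$ is $k$-inconsistent. For a type $p$, þ$(p,\Delta,\Pi,k)=\min\{$þ$(\phi,\Delta,\Pi,k):\phi\in p\}$. $T$ is rosy if þ$(p,\Delta,\Pi,k)$ is finite for every type $p$, all finite sets $\Delta,\Pi$ of formulas and every $k\in\mathbb N$. *)

theory Defs
  imports Main "HOL-Library.Equipollence" "HOL-Library.Extended_Nat"
begin

section \<open>Many-sorted first-order logic\<close>

text \<open>
  A variable is a pair of an index and a sort. Single-sorted logic is the instance in which
  the type of sorts is \<open>unit\<close>.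
\<close>

datatype ('v, 's, 'f) tm = Var "'v \<times> 's" | Fn 'f "('v, 's, 'f) tm list"

datatype ('v, 's, 'f, 'r) fm =
    Eq "('v, 's, 'f) tm" "('v, 's, 'f) tm"
  | Rel 'r "('v, 's, 'f) tm list"
  | Neg "('v, 's, 'f, 'r) fm"
  | And "('v, 's, 'f, 'r) fm" "('v, 's, 'f, 'r) fm"
  | Ex "'v \<times> 's" "('v, 's, 'f, 'r) fm"

record ('s, 'f, 'r) lang =
  Sorts :: "'s set"
  Funs :: "'f set"
  Rels :: "'r set"
  fdom :: "'f \<Rightarrow> 's list"
  fcod :: "'f \<Rightarrow> 's"
  rdom :: "'r \<Rightarrow> 's list"

definition wf_lang :: "('s, 'f, 'r) lang \<Rightarrow> bool" where
  "wf_lang L \<longleftrightarrow> Sorts L \<noteq> {}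
     \<and> (\<forall>f\<in>Funs L. set (fdom L f) \<subseteq> Sorts L \<and> fcod L f \<in> Sorts L)
     \<and> (\<forall>r\<in>Rels L. set (rdom L r) \<subseteq> Sorts L)"

fun tm_sort :: "('s, 'f, 'r) lang \<Rightarrow> ('v, 's, 'f) tm \<Rightarrow> 's" where
  "tm_sort L (Var x) = snd x"
| "tm_sort L (Fn f ts) = fcod L f"

fun wf_tm :: "('s, 'f, 'r) lang \<Rightarrow> ('v, 's, 'f) tm \<Rightarrow> bool" where
  "wf_tm L (Var x) \<longleftrightarrow> snd x \<in> Sorts L"
| "wf_tm L (Fn f ts) \<longleftrightarrow>
     f \<in> Funs L \<and> map (tm_sort L) ts = fdom L f \<and> (\<forall>t\<in>set ts. wf_tm L t)"

primrec wf_fm :: "('s, 'f, 'r) lang \<Rightarrow> ('v, 's, 'f, 'r) fm \<Rightarrow> bool" where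
  "wf_fm L (Eq t u) \<longleftrightarrow> wf_tm L t \<and> wf_tm L u \<and> tm_sort L t = tm_sort L u"
| "wf_fm L (Rel r ts) \<longleftrightarrow>
     r \<in> Rels L \<and> map (tm_sort L) ts = rdom L r \<and> (\<forall>t\<in>set ts. wf_tm L t)"
| "wf_fm L (Neg \<phi>) \<longleftrightarrow> wf_fm L \<phi>"
| "wf_fm L (And \<phi> \<psi>) \<longleftrightarrow> wf_fm L \<phi> \<and> wf_fm L \<psi>"
| "wf_fm L (Ex x \<phi>) \<longleftrightarrow> snd x \<in> Sorts L \<and> wf_fm L \<phi>"

fun tm_vars :: "('v, 's, 'f) tm \<Rightarrow> ('v \<times> 's) set" where
  "tm_vars (Var x) = {x}"
| "tm_vars (Fn f ts) = (\<Union>t\<in>set ts. tm_vars t)"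

primrec free_vars :: "('v, 's, 'f, 'r) fm \<Rightarrow> ('v \<times> 's) set" where
  "free_vars (Eq t u) = tm_vars t \<union> tm_vars u"
| "free_vars (Rel r ts) = (\<Union>t\<in>set ts. tm_vars t)"
| "free_vars (Neg \<phi>) = free_vars \<phi>"
| "free_vars (And \<phi> \<psi>) = free_vars \<phi> \<union> free_vars \<psi>"
| "free_vars (Ex x \<phi>) = free_vars \<phi> - {x}"

definition Form :: "('s, 'f, 'r) lang \<Rightarrow> ('v \<times> 's) set \<Rightarrow> ('v, 's, 'f, 'r) fm set" where
  "Form L X = {\<phi>. wf_fm L \<phi> \<and> free_vars \<phi> \<subseteq> X}"

text \<open>
  Every element of a structure has exactly one sort, so the carriers of distinct sorts are
  disjoint.
\<close>

record ('s, 'f, 'r, 'e) struct =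
  univ :: "'e set"
  srt :: "'e \<Rightarrow> 's"
  fint :: "'f \<Rightarrow> 'e list \<Rightarrow> 'e"
  rint :: "'r \<Rightarrow> 'e list \<Rightarrow> bool"

definition is_struct :: "('s, 'f, 'r) lang \<Rightarrow> ('s, 'f, 'r, 'e) struct \<Rightarrow> bool" where
  "is_struct L M \<longleftrightarrow> srt M ` univ M = Sorts L
     \<and> (\<forall>f\<in>Funs L. \<forall>as. set as \<subseteq> univ M \<and> map (srt M) as = fdom L f
          \<longrightarrow> fint M f as \<in> univ M \<and> srt M (fint M f as) = fcod L f)"

primrec tm_val :: "('s, 'f, 'r, 'e) struct \<Rightarrow> ('v \<times> 's \<Rightarrow> 'e) \<Rightarrow> ('v, 's, 'f) tm \<Rightarrow> 'e" where
  "tm_val M v (Var x) = v x"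
| "tm_val M v (Fn f ts) = fint M f (map (tm_val M v) ts)"

primrec sat :: "('s, 'f, 'r, 'e) struct \<Rightarrow> ('v \<times> 's \<Rightarrow> 'e) \<Rightarrow> ('v, 's, 'f, 'r) fm \<Rightarrow> bool" where
  "sat M v (Eq t u) \<longleftrightarrow> tm_val M v t = tm_val M v u"
| "sat M v (Rel r ts) \<longleftrightarrow> rint M r (map (tm_val M v) ts)"
| "sat M v (Neg \<phi>) \<longleftrightarrow> \<not> sat M v \<phi>"
| "sat M v (And \<phi> \<psi>) \<longleftrightarrow> sat M v \<phi> \<and> sat M v \<psi>"
| "sat M v (Ex x \<phi>) \<longleftrightarrow> (\<exists>a\<in>univ M. srt M a = snd x \<and> sat M (v(x := a)) \<phi>)"


section \<open>Parameters, tuples and types\<close>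

text \<open>
  Formulas with parameters are formulas of the language expanded by constants: the symbol
  \<open>Inl f\<close> is the old symbol \<open>f\<close> and \<open>Inr a\<close> is a constant naming the element \<open>a\<close>.
\<close>

type_synonym ('v, 's, 'f, 'r, 'e) pfm = "('v, 's, 'f + 'e, 'r) fm"

definition par_lang ::
  "('s, 'f, 'r) lang \<Rightarrow> ('s, 'f, 'r, 'e) struct \<Rightarrow> 'e set \<Rightarrow> ('s, 'f + 'e, 'r) lang" where
  "par_lang L M A =
     \<lparr>Sorts = Sorts L, Funs = Inl ` Funs L \<union> Inr ` A, Rels = Rels L,
      fdom = case_sum (fdom L) (\<lambda>_. []), fcod = case_sum (fcod L) (srt M), rdom = rdom L\<rparr>"

definition par_struct :: "('s, 'f, 'r, 'e) struct \<Rightarrow> ('s, 'f + 'e, 'r, 'e) struct" where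
  "par_struct M =
     \<lparr>univ = univ M, srt = srt M, fint = case_sum (fint M) (\<lambda>a _. a), rint = rint M\<rparr>"

definition PForm ::
  "('s, 'f, 'r) lang \<Rightarrow> ('s, 'f, 'r, 'e) struct \<Rightarrow> 'e set \<Rightarrow> ('v \<times> 's) set
     \<Rightarrow> ('v, 's, 'f, 'r, 'e) pfm set" where
  "PForm L M A X = Form (par_lang L M A) X"

text \<open>
  A tuple is indexed by the variables for which it is to be substituted: a tuple for the
  variable tuple \<open>X\<close> is a partial map with domain \<open>X\<close>.
\<close>

type_synonym ('v, 's, 'e) tuple = "('v \<times> 's) \<rightharpoonup> 'e"

definition tuples :: "('s, 'f, 'r, 'e) struct \<Rightarrow> ('v \<times> 's) set \<Rightarrow> ('v, 's, 'e) tuple set" where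
  "tuples M X = {a. dom a = X \<and> (\<forall>x e. a x = Some e \<longrightarrow> e \<in> univ M \<and> srt M e = snd x)}"

text \<open>\<open>holds M b \<phi>\<close> is meant for formulas whose free variables lie in the domain of \<open>b\<close>.\<close>

definition holds ::
  "('s, 'f, 'r, 'e) struct \<Rightarrow> ('v, 's, 'e) tuple \<Rightarrow> ('v, 's, 'f, 'r, 'e) pfm \<Rightarrow> bool" where
  "holds M b \<phi> \<longleftrightarrow> sat (par_struct M) (\<lambda>x. the (b x)) \<phi>"

primrec inst_tm :: "('v, 's, 'e) tuple \<Rightarrow> ('v, 's, 'f) tm \<Rightarrow> ('v, 's, 'f + 'e) tm" where
  "inst_tm a (Var x) = (case a x of None \<Rightarrow> Var x | Some e \<Rightarrow> Fn (Inr e) [])"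
| "inst_tm a (Fn f ts) = Fn (Inl f) (map (inst_tm a) ts)"

text \<open>
  For \<open>\<delta>(x;y)\<close> and a tuple \<open>a\<close> for \<open>y\<close>, \<open>inst a \<delta>\<close> is the formula with parameters \<open>\<delta>(x,a)\<close>.
\<close>

primrec inst :: "('v, 's, 'e) tuple \<Rightarrow> ('v, 's, 'f, 'r) fm \<Rightarrow> ('v, 's, 'f, 'r, 'e) pfm" where
  "inst a (Eq t u) = Eq (inst_tm a t) (inst_tm a u)"
| "inst a (Rel r ts) = Rel r (map (inst_tm a) ts)"
| "inst a (Neg \<phi>) = Neg (inst a \<phi>)"
| "inst a (And \<phi> \<psi>) = And (inst a \<phi>) (inst a \<psi>)"
| "inst a (Ex x \<phi>) = Ex x (inst (a(x := None)) \<phi>)"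

definition consistent ::
  "('s, 'f, 'r, 'e) struct \<Rightarrow> ('v \<times> 's) set \<Rightarrow> ('v, 's, 'f, 'r, 'e) pfm set \<Rightarrow> bool" where
  "consistent M X p \<longleftrightarrow>
     (\<forall>q. q \<subseteq> p \<and> finite q \<longrightarrow> (\<exists>b\<in>tuples M X. \<forall>\<phi>\<in>q. holds M b \<phi>))"

definition tp ::
  "('s, 'f, 'r) lang \<Rightarrow> ('s, 'f, 'r, 'e) struct \<Rightarrow> 'e set \<Rightarrow> ('v, 's, 'e) tuple
     \<Rightarrow> ('v, 's, 'f, 'r, 'e) pfm set" where
  "tp L M A a = {\<phi> \<in> PForm L M A (dom a). holds M a \<phi>}"

definition realisations ::
  "('s, 'f, 'r, 'e) struct \<Rightarrow> ('v \<times> 's) set \<Rightarrow> ('v, 's, 'f, 'r, 'e) pfm set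
     \<Rightarrow> ('v, 's, 'e) tuple set" where
  "realisations M X p = {b \<in> tuples M X. \<forall>\<phi>\<in>p. holds M b \<phi>}"

definition small :: "('s, 'f, 'r, 'e) struct \<Rightarrow> 'e set \<Rightarrow> bool" where
  "small M A \<longleftrightarrow> A \<subseteq> univ M \<and> A \<prec> univ M"


section \<open>Complete theories and monster models\<close>

definition models ::
  "('s, 'f, 'r) lang \<Rightarrow> ('s, 'f, 'r, 'e) struct \<Rightarrow> (nat, 's, 'f, 'r) fm set \<Rightarrow> bool" where
  "models L M T \<longleftrightarrow> is_struct L M \<and> (\<forall>\<phi>\<in>T. \<forall>v. sat M v \<phi>)"

text \<open>
  Entailment is tested in structures with elements in a fixed type. If that type has more
  elements than there are formulas of the language (as is the case for the type of elements of
  a monster model), this is ordinary entailment by Loewenheim--Skolem.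
\<close>

definition entails ::
  "'e itself \<Rightarrow> ('s, 'f, 'r) lang \<Rightarrow> (nat, 's, 'f, 'r) fm set \<Rightarrow> (nat, 's, 'f, 'r) fm \<Rightarrow> bool" where
  "entails e L T \<phi> \<longleftrightarrow> (\<forall>M :: ('s, 'f, 'r, 'e) struct. models L M T \<longrightarrow> models L M {\<phi>})"

definition complete_theory ::
  "'e itself \<Rightarrow> ('s, 'f, 'r) lang \<Rightarrow> (nat, 's, 'f, 'r) fm set \<Rightarrow> bool" where
  "complete_theory e L T \<longleftrightarrow> T \<subseteq> Form L {}
     \<and> (\<exists>M :: ('s, 'f, 'r, 'e) struct. models L M T)
     \<and> (\<forall>\<phi>\<in>Form L {}. entails e L T \<phi> \<or> entails e L T (Neg \<phi>))"

definition saturated :: "('s, 'f, 'r) lang \<Rightarrow> ('s, 'f, 'r, 'e) struct \<Rightarrow> bool" where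
  "saturated L M \<longleftrightarrow>
     (\<forall>A (x :: nat \<times> 's) p. small M A \<and> p \<subseteq> PForm L M A {x} \<and> consistent M {x} p
        \<longrightarrow> realisations M {x} p \<noteq> {})"

text \<open>The last three conjuncts of \<open>monster\<close> say that \<open>|M| > |L| + \<aleph>\<^sub>0\<close>.\<close>

definition monster ::
  "('s, 'f, 'r) lang \<Rightarrow> (nat, 's, 'f, 'r) fm set \<Rightarrow> ('s, 'f, 'r, 'e) struct \<Rightarrow> bool" where
  "monster L T M \<longleftrightarrow> models L M T \<and> saturated L M
     \<and> (UNIV :: nat set) \<prec> univ M \<and> Funs L \<prec> univ M \<and> Rels L \<prec> univ M"


section \<open>The structure of imaginaries\<close>

datatype ('f, 'r) eq_sort = Home | Imag nat "(nat, unit, 'f, 'r) fm"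

datatype ('f, 'r) eq_fun = Old 'f | Proj nat "(nat, unit, 'f, 'r) fm"

datatype ('f, 'r, 'e) eq_elem =
    Real (the_real: 'e)
  | Class nat "(nat, unit, 'f, 'r) fm" "'e list set"

definition ntuples :: "('s, 'f, 'r, 'e) struct \<Rightarrow> nat \<Rightarrow> 'e list set" where
  "ntuples M n = {a. length a = n \<and> set a \<subseteq> univ M}"

text \<open>
  In a formula \<open>E(x,y)\<close> defining a relation between \<open>n\<close>-tuples, \<open>x\<close> consists of the variables
  \<open>0, \<dots>, n-1\<close> and \<open>y\<close> of the variables \<open>n, \<dots>, 2n-1\<close>.
\<close>

definition eq_rel ::
  "(unit, 'f, 'r, 'e) struct \<Rightarrow> nat \<Rightarrow> (nat, unit, 'f, 'r) fm \<Rightarrow> ('e list \<times> 'e list) set" where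
  "eq_rel M n E =
     {(a, b). a \<in> ntuples M n \<and> b \<in> ntuples M n \<and> sat M (\<lambda>x. (a @ b) ! fst x) E}"

definition def_equiv ::
  "(unit, 'f, 'r) lang \<Rightarrow> (unit, 'f, 'r, 'e) struct \<Rightarrow> nat \<Rightarrow> (nat, unit, 'f, 'r) fm \<Rightarrow> bool" where
  "def_equiv L M n E \<longleftrightarrow>
     0 < n \<and> E \<in> Form L ({..<2 * n} \<times> UNIV) \<and> equiv (ntuples M n) (eq_rel M n E)"

definition eq_lang ::
  "(unit, 'f, 'r) lang \<Rightarrow> (unit, 'f, 'r, 'e) struct
     \<Rightarrow> (('f, 'r) eq_sort, ('f, 'r) eq_fun, 'r) lang" where
  "eq_lang L M =
     \<lparr>Sorts = insert Home {Imag n E | n E. def_equiv L M n E},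
      Funs = Old ` Funs L \<union> {Proj n E | n E. def_equiv L M n E},
      Rels = Rels L,
      fdom = (\<lambda>f. case f of Old g \<Rightarrow> map (\<lambda>_. Home) (fdom L g) | Proj n E \<Rightarrow> replicate n Home),
      fcod = (\<lambda>f. case f of Old g \<Rightarrow> Home | Proj n E \<Rightarrow> Imag n E),
      rdom = (\<lambda>r. map (\<lambda>_. Home) (rdom L r))\<rparr>"

definition eq_struct ::
  "(unit, 'f, 'r) lang \<Rightarrow> (unit, 'f, 'r, 'e) struct
     \<Rightarrow> (('f, 'r) eq_sort, ('f, 'r) eq_fun, 'r, ('f, 'r, 'e) eq_elem) struct" where
  "eq_struct L M =
     \<lparr>univ = Real ` univ M
        \<union> {Class n E (eq_rel M n E `` {a}) | n E a. def_equiv L M n E \<and> a \<in> ntuples M n},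
      srt = (\<lambda>e. case e of Real a \<Rightarrow> Home | Class n E C \<Rightarrow> Imag n E),
      fint = (\<lambda>f as. case f of
          Old g \<Rightarrow> Real (fint M g (map the_real as))
        | Proj n E \<Rightarrow> Class n E (eq_rel M n E `` {map the_real as})),
      rint = (\<lambda>r as. rint M r (map the_real as))\<rparr>"


section \<open>Simplicity and forking\<close>

definition k_inconsistent ::
  "('s, 'f, 'r, 'e) struct \<Rightarrow> ('v \<times> 's) set \<Rightarrow> ('v, 's, 'f, 'r) fm \<Rightarrow> nat
     \<Rightarrow> ('v, 's, 'e) tuple set \<Rightarrow> bool" where
  "k_inconsistent M X \<delta> k S \<longleftrightarrow>
     (\<forall>F. F \<subseteq> S \<and> finite F \<and> card F = k \<longrightarrow> \<not> consistent M X ((\<lambda>a. inst a \<delta>) ` F))"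

text \<open>
  For sequences, as opposed to sets of parameters, the \<open>k\<close> instances are taken at pairwise
  distinct indices; the parameters may repeat.
\<close>

definition k_inconsistent_seq ::
  "('s, 'f, 'r, 'e) struct \<Rightarrow> ('v \<times> 's) set \<Rightarrow> ('v, 's, 'f, 'r) fm \<Rightarrow> nat
     \<Rightarrow> (nat \<Rightarrow> ('v, 's, 'e) tuple) \<Rightarrow> bool" where
  "k_inconsistent_seq M X \<delta> k s \<longleftrightarrow>
     (\<forall>I. finite I \<and> card I = k \<longrightarrow> \<not> consistent M X ((\<lambda>i. inst (s i) \<delta>) ` I))"

text \<open>The tree is indexed by the nonempty finite sequences of natural numbers.\<close>

definition tree_property ::
  "('s, 'f, 'r, 'e) struct \<Rightarrow> ('v \<times> 's) set \<Rightarrow> ('v \<times> 's) set \<Rightarrow> ('v, 's, 'f, 'r) fm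
     \<Rightarrow> nat \<Rightarrow> bool" where
  "tree_property M X Y \<phi> k \<longleftrightarrow> (\<exists>a :: nat list \<Rightarrow> ('v, 's, 'e) tuple.
     (\<forall>\<eta>. \<eta> \<noteq> [] \<longrightarrow> a \<eta> \<in> tuples M Y)
     \<and> (\<forall>\<eta>. k_inconsistent_seq M X \<phi> k (\<lambda>i. a (\<eta> @ [i])))
     \<and> (\<forall>\<sigma> :: nat \<Rightarrow> nat. consistent M X {inst (a (map \<sigma> [0..<n])) \<phi> | n. 0 < n}))"

definition simple :: "('s, 'f, 'r) lang \<Rightarrow> ('s, 'f, 'r, 'e) struct \<Rightarrow> bool" where
  "simple L M \<longleftrightarrow> \<not> (\<exists>(X :: (nat \<times> 's) set) Y \<phi> k. finite X \<and> finite Y \<and> X \<inter> Y = {}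
     \<and> \<phi> \<in> Form L (X \<union> Y) \<and> tree_property M X Y \<phi> k)"

text \<open>
  \<open>is_instance L M X \<delta> a\<close>: the pair \<open>(\<delta>, a)\<close> presents a formula \<open>\<delta>(x,a)\<close> in the
  variables \<open>X\<close>, where \<open>\<delta>(x;y)\<close> is parameter-free and \<open>y\<close> is the domain of \<open>a\<close>.
\<close>

definition is_instance ::
  "('s, 'f, 'r) lang \<Rightarrow> ('s, 'f, 'r, 'e) struct \<Rightarrow> ('v \<times> 's) set
     \<Rightarrow> ('v, 's, 'f, 'r) fm \<Rightarrow> ('v, 's, 'e) tuple \<Rightarrow> bool" where
  "is_instance L M X \<delta> a \<longleftrightarrow> finite (dom a) \<and> X \<inter> dom a = {}
     \<and> a \<in> tuples M (dom a) \<and> \<delta> \<in> Form L (X \<union> dom a)"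

definition divides ::
  "('s, 'f, 'r) lang \<Rightarrow> ('s, 'f, 'r, 'e) struct \<Rightarrow> 'e set \<Rightarrow> ('v \<times> 's) set
     \<Rightarrow> ('v, 's, 'f, 'r) fm \<Rightarrow> ('v, 's, 'e) tuple \<Rightarrow> bool" where
  "divides L M A X \<delta> a \<longleftrightarrow> is_instance L M X \<delta> a
     \<and> (\<exists>k s. (\<forall>i. s i \<in> realisations M (dom a) (tp L M A a)) \<and> k_inconsistent_seq M X \<delta> k s)"

definition implies_disjunction ::
  "('s, 'f, 'r, 'e) struct \<Rightarrow> ('v \<times> 's) set \<Rightarrow> ('v, 's, 'f, 'r, 'e) pfm
     \<Rightarrow> (('v, 's, 'f, 'r) fm \<times> ('v, 's, 'e) tuple) set \<Rightarrow> bool" where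
  "implies_disjunction M X \<phi> D \<longleftrightarrow>
     (\<forall>b\<in>tuples M X. holds M b \<phi> \<longrightarrow> (\<exists>(\<delta>, a)\<in>D. holds M b (inst a \<delta>)))"

definition forks ::
  "('s, 'f, 'r) lang \<Rightarrow> ('s, 'f, 'r, 'e) struct \<Rightarrow> 'e set \<Rightarrow> ('v \<times> 's) set
     \<Rightarrow> ('v, 's, 'f, 'r, 'e) pfm \<Rightarrow> bool" where
  "forks L M A X \<phi> \<longleftrightarrow>
     (\<exists>D. finite D \<and> (\<forall>(\<delta>, a)\<in>D. divides L M A X \<delta> a) \<and> implies_disjunction M X \<phi> D)"

text \<open>
  For the types of infinite tuples there must be enough variables. In such contexts variables
  are indexed by \<open>nat + 'e\<close>, and the set \<open>A\<close> is enumerated by the variables with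
  index \<open>Inr a\<close> for \<open>a \<in> A\<close>.
\<close>

definition enum :: "('s, 'f, 'r, 'e) struct \<Rightarrow> 'e set \<Rightarrow> (nat + 'e, 's, 'e) tuple" where
  "enum M A = (\<lambda>(i, s). case i of
     Inl n \<Rightarrow> None | Inr a \<Rightarrow> if a \<in> A \<and> srt M a = s then Some a else None)"

text \<open>\<open>fork_indep L M A C B\<close>: \<open>A\<close> is independent from \<open>B\<close> over \<open>C\<close>.\<close>

definition fork_indep ::
  "('s, 'f, 'r) lang \<Rightarrow> ('s, 'f, 'r, 'e) struct \<Rightarrow> 'e set \<Rightarrow> 'e set \<Rightarrow> 'e set \<Rightarrow> bool" where
  "fork_indep L M A C B \<longleftrightarrow>
     \<not> (\<exists>\<phi>\<in>tp L M (B \<union> C) (enum M A). forks L M C (dom (enum M A)) \<phi>)"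


section \<open>Thorn-forking\<close>

definition strongly_divides ::
  "('s, 'f, 'r) lang \<Rightarrow> ('s, 'f, 'r, 'e) struct \<Rightarrow> 'e set \<Rightarrow> ('v \<times> 's) set
     \<Rightarrow> ('v, 's, 'f, 'r) fm \<Rightarrow> ('v, 's, 'e) tuple \<Rightarrow> bool" where
  "strongly_divides L M A X \<delta> a \<longleftrightarrow> is_instance L M X \<delta> a
     \<and> infinite (realisations M (dom a) (tp L M A a))
     \<and> (\<exists>k. k_inconsistent M X \<delta> k (realisations M (dom a) (tp L M A a)))"

text \<open>The tuple \<open>c\<close> enters only through the set \<open>c\<close> of its entries.\<close>

definition thorn_divides ::
  "('s, 'f, 'r) lang \<Rightarrow> ('s, 'f, 'r, 'e) struct \<Rightarrow> 'e set \<Rightarrow> ('v \<times> 's) set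
     \<Rightarrow> ('v, 's, 'f, 'r) fm \<Rightarrow> ('v, 's, 'e) tuple \<Rightarrow> bool" where
  "thorn_divides L M A X \<delta> a \<longleftrightarrow> (\<exists>c. small M c \<and> strongly_divides L M (A \<union> c) X \<delta> a)"

definition thorn_forks ::
  "('s, 'f, 'r) lang \<Rightarrow> ('s, 'f, 'r, 'e) struct \<Rightarrow> 'e set \<Rightarrow> ('v \<times> 's) set
     \<Rightarrow> ('v, 's, 'f, 'r, 'e) pfm \<Rightarrow> bool" where
  "thorn_forks L M A X \<phi> \<longleftrightarrow>
     (\<exists>D. finite D \<and> (\<forall>(\<delta>, a)\<in>D. thorn_divides L M A X \<delta> a) \<and> implies_disjunction M X \<phi> D)"

definition thorn_indep ::
  "('s, 'f, 'r) lang \<Rightarrow> ('s, 'f, 'r, 'e) struct \<Rightarrow> 'e set \<Rightarrow> 'e set \<Rightarrow> 'e set \<Rightarrow> bool" where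
  "thorn_indep L M A C B \<longleftrightarrow>
     \<not> (\<exists>\<phi>\<in>tp L M (B \<union> C) (enum M A). thorn_forks L M C (dom (enum M A)) \<phi>)"


section \<open>Thorn-rank and rosiness\<close>

definition is_succ :: "'o::wellorder \<Rightarrow> 'o \<Rightarrow> bool" where
  "is_succ \<beta> \<alpha> \<longleftrightarrow> \<alpha> < \<beta> \<and> (\<forall>\<gamma>. \<alpha> < \<gamma> \<longrightarrow> \<beta> \<le> \<gamma>)"

definition is_limit :: "'o::wellorder \<Rightarrow> bool" where
  "is_limit \<beta> \<longleftrightarrow> (\<exists>\<alpha>. \<alpha> < \<beta>) \<and> (\<forall>\<alpha><\<beta>. \<exists>\<gamma>. \<alpha> < \<gamma> \<and> \<gamma> < \<beta>)"

definition solutions ::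
  "('s, 'f, 'r, 'e) struct \<Rightarrow> ('v \<times> 's) set \<Rightarrow> ('v, 's, 'f, 'r) fm \<Rightarrow> ('v, 's, 'e) tuple
     \<Rightarrow> ('v, 's, 'e) tuple set" where
  "solutions M Y \<pi> c = {a \<in> tuples M Y. holds M a (inst c \<pi>)}"

text \<open>
  \<open>thorn_ge M X Y Z \<Delta> \<Gamma> k \<alpha> \<phi>\<close> says that the rank of \<open>\<phi>\<close> is at least \<open>\<alpha>\<close>; the ordinal \<open>\<alpha>\<close>
  ranges over an arbitrary well-ordered type. As that order is well-founded, the rules below
  have exactly one solution.
\<close>

inductive thorn_ge ::
  "('s, 'f, 'r, 'e) struct \<Rightarrow> ('v \<times> 's) set \<Rightarrow> ('v \<times> 's) set \<Rightarrow> ('v \<times> 's) set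
     \<Rightarrow> ('v, 's, 'f, 'r) fm set \<Rightarrow> ('v, 's, 'f, 'r) fm set \<Rightarrow> nat
     \<Rightarrow> 'o::wellorder \<Rightarrow> ('v, 's, 'f, 'r, 'e) pfm \<Rightarrow> bool"
  for M X Y Z \<Delta> \<Gamma> k where
  zero: "thorn_ge M X Y Z \<Delta> \<Gamma> k \<alpha> \<phi>"
    if "\<forall>\<beta>. \<alpha> \<le> \<beta>" and "consistent M X {\<phi>}"
| limit: "thorn_ge M X Y Z \<Delta> \<Gamma> k \<alpha> \<phi>"
    if "is_limit \<alpha>" and "\<forall>\<beta><\<alpha>. thorn_ge M X Y Z \<Delta> \<Gamma> k \<beta> \<phi>"
| succ: "thorn_ge M X Y Z \<Delta> \<Gamma> k \<beta> \<phi>"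
    if "is_succ \<beta> \<alpha>" and "\<delta> \<in> \<Delta>" and "\<pi> \<in> \<Gamma>" and "c \<in> tuples M Z"
      and "S \<subseteq> solutions M Y \<pi> c" and "infinite S"
      and "\<forall>a\<in>S. thorn_ge M X Y Z \<Delta> \<Gamma> k \<alpha> (And \<phi> (inst a \<delta>))"
      and "k_inconsistent M X \<delta> k (solutions M Y \<pi> c)"

text \<open>
  The values of the rank are recorded in \<open>enat\<close>, which is the well-order of the ordinals up to
  and including \<open>\<omega>\<close>, with \<open>\<infinity>\<close> in the role of \<open>\<omega>\<close>. All infinite values of the rank are
  thus identified with \<open>\<infinity>\<close>.
\<close>

definition thorn_rank ::
  "('s, 'f, 'r, 'e) struct \<Rightarrow> ('v \<times> 's) set \<Rightarrow> ('v \<times> 's) set \<Rightarrow> ('v \<times> 's) set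
     \<Rightarrow> ('v, 's, 'f, 'r) fm set \<Rightarrow> ('v, 's, 'f, 'r) fm set \<Rightarrow> nat
     \<Rightarrow> ('v, 's, 'f, 'r, 'e) pfm \<Rightarrow> enat" where
  "thorn_rank M X Y Z \<Delta> \<Gamma> k \<phi> = Sup {\<alpha>. thorn_ge M X Y Z \<Delta> \<Gamma> k \<alpha> \<phi>}"

definition thorn_rank_type ::
  "('s, 'f, 'r, 'e) struct \<Rightarrow> ('v \<times> 's) set \<Rightarrow> ('v \<times> 's) set \<Rightarrow> ('v \<times> 's) set
     \<Rightarrow> ('v, 's, 'f, 'r) fm set \<Rightarrow> ('v, 's, 'f, 'r) fm set \<Rightarrow> nat
     \<Rightarrow> ('v, 's, 'f, 'r, 'e) pfm set \<Rightarrow> enat" where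
  "thorn_rank_type M X Y Z \<Delta> \<Gamma> k p = (INF \<phi>\<in>p. thorn_rank M X Y Z \<Delta> \<Gamma> k \<phi>)"

definition rosy :: "('s, 'f, 'r) lang \<Rightarrow> ('s, 'f, 'r, 'e) struct \<Rightarrow> bool" where
  "rosy L M \<longleftrightarrow>
     (\<forall>(X :: ((nat + 'e) \<times> 's) set) Y Z \<Delta> \<Gamma> k A p.
        finite X \<and> finite Y \<and> X \<inter> Y = {} \<and> Y \<inter> Z = {}
        \<and> finite \<Delta> \<and> \<Delta> \<subseteq> Form L (X \<union> Y) \<and> finite \<Gamma> \<and> \<Gamma> \<subseteq> Form L (Y \<union> Z)
        \<and> small M A \<and> p \<subseteq> PForm L M A X \<and> p \<noteq> {} \<and> consistent M X p
        \<longrightarrow> thorn_rank_type M X Y Z \<Delta> \<Gamma> k p \<noteq> \<infinity>)"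

end

theory Submission
  imports Defs "HOL-Library.Countable"
begin

text \<open>
  An infinite set of realisations contains an injective sequence, so strong division over
  \<open>A \<union> c\<close> is a special case of division over \<open>A \<union> c\<close>, and a sequence witnessing the latter also
  witnesses division over \<open>A\<close>. Hence thorn-forking implies forking in every theory.

  For rosiness, the formulas \<open>\<pi>\<close> of the rank only serve to produce infinite \<open>k\<close>-inconsistent sets
  of parameters. A type of infinite rank thus gives, for a single \<open>\<delta>\<close>, trees of every finite depth
  in the expansion by imaginaries. Replacing imaginaries by representatives moves these trees to
  the home sort, where compactness, obtained by realising countably many variables one after the
  other, combines them into a tree of infinite depth. This is the tree property.
\<close>

section \<open>Formulas with parameters\<close>

text \<open>Saturation is assumed of the home structure only, and only for types in one variable
  over small sets. This dictates the order of the steps: trees are carried through the imaginaries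
  while their depth is finite, and infinite depth is reached afterwards in the home sort. Trees are
  stated for an abstract relation between solutions and parameters, so that this passage reduces to
  a map of solutions and a choice of representatives. An infinite rank enters only through
  arbitrarily large finite values. In the definition of the rank the formula of
  \<open>\<Delta>\<close> may change from one extension to the next; rank at least
  \<open>n * card \<Delta>\<close> leaves room for \<open>n\<close> levels that use the same
  formula. In the home sort a tree is a valuation of countably many variables, one for each entry of
  each node. Inconsistency of siblings and consistency of branches then become formulas in these
  variables, since the existence of a common solution of finitely many instances is
  definable.\<close>

lemma tm_sort_par_lang_indep: "tm_sort (par_lang L M A) t = tm_sort (par_lang L M B) t"
  by (cases t) (simp_all add: par_lang_def)

lemma wf_tm_par_lang_mono:
  assumes "A \<subseteq> B"
  shows "wf_tm (par_lang L M A) t \<Longrightarrow> wf_tm (par_lang L M B) t"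
proof (induction t)
  case (Var x)
  then show ?case by (simp add: par_lang_def)
next
  case (Fn f ts)
  have "map (tm_sort (par_lang L M B)) ts = map (tm_sort (par_lang L M A)) ts"
    using tm_sort_par_lang_indep by (metis map_eq_conv)
  with Fn assms show ?case by (auto simp: par_lang_def)
qed

lemma wf_fm_par_lang_mono:
  assumes "A \<subseteq> B"
  shows "wf_fm (par_lang L M A) \<phi> \<Longrightarrow> wf_fm (par_lang L M B) \<phi>"
proof (induction \<phi>)
  case (Eq t u)
  then show ?case
    using wf_tm_par_lang_mono[OF assms] tm_sort_par_lang_indep by (metis wf_fm.simps(1))
next
  case (Rel r ts)
  have "map (tm_sort (par_lang L M B)) ts = map (tm_sort (par_lang L M A)) ts"
    using tm_sort_par_lang_indep by (metis map_eq_conv)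
  with Rel wf_tm_par_lang_mono[OF assms] show ?case by (auto simp: par_lang_def)
next
  case (Ex x \<phi>)
  then show ?case by (simp add: par_lang_def)
qed auto

lemma tp_mono: "A \<subseteq> B \<Longrightarrow> tp L M A a \<subseteq> tp L M B a"
  using wf_fm_par_lang_mono by (fastforce simp: tp_def PForm_def Form_def)

lemma tm_val_cong: "(\<And>x. x \<in> tm_vars t \<Longrightarrow> v x = w x) \<Longrightarrow> tm_val M v t = tm_val M w t"
proof (induction t)
  case (Fn f ts)
  then have "map (tm_val M v) ts = map (tm_val M w) ts" by (auto intro!: map_cong)
  then show ?case by (metis tm_val.simps(2))
qed simp

lemma sat_cong: "(\<And>x. x \<in> free_vars \<phi> \<Longrightarrow> v x = w x) \<Longrightarrow> sat M v \<phi> \<longleftrightarrow> sat M w \<phi>"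
proof (induction \<phi> arbitrary: v w)
  case (Eq t u)
  then have "tm_val M v t = tm_val M w t" "tm_val M v u = tm_val M w u"
    by (auto intro!: tm_val_cong)
  then show ?case by simp
next
  case (Rel r ts)
  then have "map (tm_val M v) ts = map (tm_val M w) ts"
    by (auto intro!: map_cong tm_val_cong)
  then show ?case by (metis sat.simps(2))
next
  case (Neg \<phi>)
  have "sat M v \<phi> \<longleftrightarrow> sat M w \<phi>" by (rule Neg.IH) (use Neg.prems in simp)
  then show ?case by simp
next
  case (And \<phi> \<psi>)
  have "sat M v \<phi> \<longleftrightarrow> sat M w \<phi>" by (rule And.IH) (use And.prems in simp)
  moreover have "sat M v \<psi> \<longleftrightarrow> sat M w \<psi>" by (rule And.IH) (use And.prems in simp)
  ultimately show ?case by simp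
next
  case (Ex x \<phi>)
  have "sat M (v(x := a)) \<phi> \<longleftrightarrow> sat M (w(x := a)) \<phi>" for a
    by (rule Ex.IH) (use Ex.prems in auto)
  then show ?case by simp
qed

lemma par_struct_sel:
  "univ (par_struct M) = univ M" "srt (par_struct M) = srt M" "rint (par_struct M) = rint M"
  "fint (par_struct M) (Inl f) = fint M f" "fint (par_struct M) (Inr a) as = a"
  by (simp_all add: par_struct_def)

lemma tm_val_inst:
  "tm_val (par_struct M) v (inst_tm a t) = tm_val M (\<lambda>x. case a x of None \<Rightarrow> v x | Some e \<Rightarrow> e) t"
proof (induction t)
  case (Var x)
  then show ?case by (simp add: par_struct_sel split: option.split)
next
  case (Fn f ts)
  then have "map (tm_val (par_struct M) v) (map (inst_tm a) ts)
      = map (tm_val M (\<lambda>x. case a x of None \<Rightarrow> v x | Some e \<Rightarrow> e)) ts"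
    by auto
  then show ?case by (simp only: inst_tm.simps inst.simps tm_val.simps sat.simps par_struct_sel)
qed

lemma sat_inst:
  "sat (par_struct M) v (inst a \<phi>) \<longleftrightarrow> sat M (\<lambda>x. case a x of None \<Rightarrow> v x | Some e \<Rightarrow> e) \<phi>"
proof (induction \<phi> arbitrary: v a)
  case (Rel r ts)
  have "map (tm_val (par_struct M) v) (map (inst_tm a) ts)
      = map (tm_val M (\<lambda>x. case a x of None \<Rightarrow> v x | Some e \<Rightarrow> e)) ts"
    by (auto simp: tm_val_inst)
  then show ?case by (simp only: inst_tm.simps inst.simps tm_val.simps sat.simps par_struct_sel)
next
  case (Ex x \<phi>)
  \<comment> \<open>\<open>inst\<close> deletes the bound variable from the tuple, so the value
    chosen by the quantifier is read there and not a parameter.\<close>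
  have "(\<lambda>y. case (a(x := None)) y of None \<Rightarrow> (v(x := e)) y | Some e \<Rightarrow> e)
      = (\<lambda>y. case a y of None \<Rightarrow> v y | Some e \<Rightarrow> e)(x := e)" for e
    by (rule ext) (auto split: option.split)
  then show ?case by (simp add: Ex.IH par_struct_sel)
qed (simp_all add: tm_val_inst)

text \<open>Substituting parameters amounts to changing the valuation, with \<open>a\<close>
  overriding \<open>b\<close>. Questions about instances thus become comparisons of valuations on
  the free variables of a parameter-free formula, where \<open>sat_cong\<close> applies.\<close>

lemma holds_inst: "holds M b (inst a \<phi>) \<longleftrightarrow> sat M (\<lambda>x. the ((b ++ a) x)) \<phi>"
proof -
  have "(\<lambda>x. case a x of None \<Rightarrow> the (b x) | Some e \<Rightarrow> e) = (\<lambda>x. the ((b ++ a) x))"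
    by (auto simp: map_add_def split: option.split)
  then show ?thesis by (simp add: holds_def sat_inst)
qed

lemma holds_And: "holds M b (And \<phi> \<psi>) \<longleftrightarrow> holds M b \<phi> \<and> holds M b \<psi>"
  by (simp add: holds_def)

lemma dom_tuples: "a \<in> tuples M X \<Longrightarrow> dom a = X"
  unfolding tuples_def by blast

lemma tuples_Some: "a \<in> tuples M X \<Longrightarrow> a x = Some e \<Longrightarrow> e \<in> univ M \<and> srt M e = snd x"
  unfolding tuples_def by blast

lemma tuples_the: "a \<in> tuples M X \<Longrightarrow> x \<in> X \<Longrightarrow> the (a x) \<in> univ M \<and> srt M (the (a x)) = snd x"
  using dom_tuples[of a M X] tuples_Some[of a M X x] by (metis domD option.sel)

lemma tuples_map_add:
  assumes "a \<in> tuples M X" "b \<in> tuples M Y"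
  shows "a ++ b \<in> tuples M (X \<union> Y)"
proof -
  have "dom (a ++ b) = X \<union> Y"
    using dom_tuples[OF assms(1)] dom_tuples[OF assms(2)] by auto
  moreover have "e \<in> univ M \<and> srt M e = snd x" if "(a ++ b) x = Some e" for x e
    using map_add_SomeD[OF that] tuples_Some[OF assms(1), of x e] tuples_Some[OF assms(2), of x e]
    by blast
  ultimately show ?thesis unfolding tuples_def by blast
qed

lemma consistent_finite:
  "finite p \<Longrightarrow> consistent M X p \<longleftrightarrow> (\<exists>b\<in>tuples M X. \<forall>\<phi>\<in>p. holds M b \<phi>)"
  unfolding consistent_def by (meson order_refl subsetD)

section \<open>Thorn-forking and forking\<close>

lemma thorn_divides_imp_divides:
  assumes "thorn_divides L M A X \<delta> a"
  shows "divides L M A X \<delta> a"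
proof -
  from assms obtain c k where
    inst: "is_instance L M X \<delta> a"
    and inf: "infinite (realisations M (dom a) (tp L M (A \<union> c) a))"
    and k: "k_inconsistent M X \<delta> k (realisations M (dom a) (tp L M (A \<union> c) a))"
    by (auto simp: thorn_divides_def strongly_divides_def)
  from infinite_countable_subset[OF inf] obtain s :: "nat \<Rightarrow> _"
    where s: "inj s" "range s \<subseteq> realisations M (dom a) (tp L M (A \<union> c) a)" by blast
  have "realisations M (dom a) (tp L M (A \<union> c) a) \<subseteq> realisations M (dom a) (tp L M A a)"
    using tp_mono[of A "A \<union> c" L M a] by (auto simp: realisations_def)
  then have "\<forall>i. s i \<in> realisations M (dom a) (tp L M A a)" using s(2) by blast
  moreover have "k_inconsistent_seq M X \<delta> k s"
    unfolding k_inconsistent_seq_def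
  proof (intro allI impI)
    fix I :: "nat set" assume I: "finite I \<and> card I = k"
    \<comment> \<open>\<open>k_inconsistent\<close> counts distinct tuples and
      \<open>k_inconsistent_seq\<close> distinct indices; injectivity of \<open>s\<close> makes the
      two agree.\<close>
    have "card (s ` I) = k" using I s(1) by (metis card_image inj_on_subset subset_UNIV)
    moreover have "s ` I \<subseteq> realisations M (dom a) (tp L M (A \<union> c) a)" using s(2) by blast
    ultimately have "\<not> consistent M X ((\<lambda>a. inst a \<delta>) ` (s ` I))"
      using k I unfolding k_inconsistent_def by blast
    then show "\<not> consistent M X ((\<lambda>i. inst (s i) \<delta>) ` I)" by (simp add: image_image)
  qed
  ultimately show ?thesis using inst unfolding divides_def by blast
qed

lemma fork_indep_imp_thorn_indep:
  fixes M :: "('s, 'f, 'r, 'e) struct"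
  shows "fork_indep L M A C B \<Longrightarrow> thorn_indep L M A C B"
proof -
  assume indep: "fork_indep L M A C B"
  have "forks L M C X \<phi>" if "thorn_forks L M C X \<phi>" for X :: "((nat + 'e) \<times> 's) set" and \<phi>
  proof -
    from that obtain D where "finite D" "\<forall>(\<delta>, a)\<in>D. thorn_divides L M C X \<delta> a"
      "implies_disjunction M X \<phi> D" unfolding thorn_forks_def by blast
    then show ?thesis unfolding forks_def
      by (intro exI[of _ D]) (auto dest!: thorn_divides_imp_divides)
  qed
  then show "thorn_indep L M A C B"
    using indep unfolding fork_indep_def thorn_indep_def by blast
qed


section \<open>Trees of finite depth\<close>

definition scattered :: "('b \<Rightarrow> 'a \<Rightarrow> bool) \<Rightarrow> 'b set \<Rightarrow> nat \<Rightarrow> (nat \<Rightarrow> 'a) \<Rightarrow> bool" where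
  "scattered R B k s \<longleftrightarrow> (\<forall>I. finite I \<and> card I = k \<longrightarrow> \<not> (\<exists>b\<in>B. \<forall>i\<in>I. R b (s i)))"

text \<open>\<open>P\<close> collects the conditions met on the way from the root, so a leaf asks
  for one solution of its whole branch. The subtrees over different siblings are chosen
  independently. \<open>R\<close> stands for satisfaction of an instance; it is abstract so that
  trees in different structures can be compared.\<close>

fun deep_tree ::
  "('b \<Rightarrow> 'a \<Rightarrow> bool) \<Rightarrow> 'b set \<Rightarrow> 'a set \<Rightarrow> nat \<Rightarrow> nat \<Rightarrow> ('b \<Rightarrow> bool) \<Rightarrow> bool" where
  "deep_tree R B U k 0 P \<longleftrightarrow> (\<exists>b\<in>B. P b)"
| "deep_tree R B U k (Suc n) P \<longleftrightarrow> (\<exists>s. (\<forall>i. s i \<in> U) \<and> scattered R B k s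
     \<and> (\<forall>i. deep_tree R B U k n (\<lambda>b. P b \<and> R b (s i))))"

lemma k_inconsistent_seq_iff_scattered:
  "k_inconsistent_seq M X \<delta> k s
     \<longleftrightarrow> scattered (\<lambda>b a. holds M b (inst a \<delta>)) (tuples M X) k s"
proof -
  have "consistent M X ((\<lambda>i. inst (s i) \<delta>) ` I)
      \<longleftrightarrow> (\<exists>b\<in>tuples M X. \<forall>i\<in>I. holds M b (inst (s i) \<delta>))" if "finite I" for I
    using consistent_finite[of "(\<lambda>i. inst (s i) \<delta>) ` I"] that by simp
  then show ?thesis by (auto simp: k_inconsistent_seq_def scattered_def)
qed

lemma deep_tree_mono:
  "deep_tree R B U k n P \<Longrightarrow> (\<And>b. b \<in> B \<Longrightarrow> P b \<Longrightarrow> Q b) \<Longrightarrow> deep_tree R B U k n Q"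
proof (induction n arbitrary: P Q)
  case (Suc n)
  then obtain s where s: "\<forall>i. s i \<in> U" "scattered R B k s"
    "\<And>i. deep_tree R B U k n (\<lambda>b. P b \<and> R b (s i))" by auto
  have "deep_tree R B U k n (\<lambda>b. Q b \<and> R b (s i))" for i
    by (rule Suc.IH[OF s(3)[of i]]) (use Suc.prems(2) in auto)
  with s(1,2) show ?case unfolding deep_tree.simps by blast
next
  case 0
  then show ?case unfolding deep_tree.simps by blast
qed

lemma deep_tree_nonempty: "deep_tree R B U k n P \<Longrightarrow> \<exists>b\<in>B. P b"
proof (induction n arbitrary: P)
  case (Suc n)
  then obtain s where "deep_tree R B U k n (\<lambda>b. P b \<and> R b (s (0 :: nat)))" by auto
  from Suc.IH[OF this] show ?case by blast
qed simp

lemma deep_tree_antimono: "deep_tree R B U k n P \<Longrightarrow> m \<le> n \<Longrightarrow> deep_tree R B U k m P"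
proof (induction n arbitrary: m P)
  case (Suc n)
  show ?case
  proof (cases m)
    case 0
    then show ?thesis using deep_tree_nonempty[OF Suc.prems(1)] by simp
  next
    case m: (Suc m')
    from Suc.prems(1) obtain s where s: "\<forall>i. s i \<in> U" "scattered R B k s"
      "\<And>i. deep_tree R B U k n (\<lambda>b. P b \<and> R b (s i))" by auto
    have "deep_tree R B U k m' (\<lambda>b. P b \<and> R b (s i))" for i
      by (rule Suc.IH[OF s(3)]) (use m Suc.prems(2) in simp)
    with s(1,2) show ?thesis unfolding m deep_tree.simps by blast
  qed
qed simp

text \<open>Solutions have to be moved both ways: \<open>cls\<close> sends a common solution of
  siblings in \<open>B'\<close> to one in \<open>B\<close>, which is excluded there, and
  surjectivity lifts the solutions at the leaves back to \<open>B'\<close>. Parameters move only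
  from \<open>U\<close> to \<open>U'\<close>, and one representative for each is enough.\<close>

lemma deep_tree_transfer:
  assumes "deep_tree R B U k n P"
    and rep: "\<And>a. a \<in> U \<Longrightarrow> rep a \<in> U'"
    and cls: "cls ` B' = B"
    and R: "\<And>b a. b \<in> B' \<Longrightarrow> a \<in> U \<Longrightarrow> R' b (rep a) \<longleftrightarrow> R (cls b) a"
  shows "deep_tree R' B' U' k n (\<lambda>b. P (cls b))"
  using assms(1)
proof (induction n arbitrary: P)
  case 0
  then show ?case using cls by auto
next
  case (Suc n)
  then obtain s where s: "\<And>i. s i \<in> U" "scattered R B k s"
    "\<And>i. deep_tree R B U k n (\<lambda>b. P b \<and> R b (s i))" by auto
  have "scattered R' B' k (\<lambda>i. rep (s i))"
    unfolding scattered_def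
  proof (intro allI impI notI)
    fix I :: "nat set"
    assume I: "finite I \<and> card I = k" and "\<exists>b\<in>B'. \<forall>i\<in>I. R' b (rep (s i))"
    then obtain b where b: "b \<in> B'" "\<forall>i\<in>I. R' b (rep (s i))" by blast
    then have "\<forall>i\<in>I. R (cls b) (s i)" using R s(1) by blast
    then show False using s(2) I b(1) cls unfolding scattered_def by blast
  qed
  moreover have "deep_tree R' B' U' k n (\<lambda>b. P (cls b) \<and> R' b (rep (s i)))" for i
    by (rule deep_tree_mono[OF Suc.IH[OF s(3)[of i]]]) (use R s(1) in blast)
  ultimately show ?case
    using rep s(1) unfolding deep_tree.simps by (intro exI[of _ "\<lambda>i. rep (s i)"]) blast
qed

text \<open>The tree property and the compactness argument need one labelling by finite sequences in
  place of nested choices. The labellings of the subtrees, obtained by induction, are hung below the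
  children of the root.\<close>

lemma deep_tree_labelling:
  assumes "deep_tree R B U k n P" and "U \<noteq> {}"
  shows "\<exists>t :: nat list \<Rightarrow> _. (\<forall>\<eta>. t \<eta> \<in> U)
    \<and> (\<forall>\<eta>. length \<eta> < n \<longrightarrow> scattered R B k (\<lambda>i. t (\<eta> @ [i])))
    \<and> (\<forall>\<eta>. length \<eta> \<le> n \<longrightarrow> (\<exists>b\<in>B. P b \<and> (\<forall>j\<in>{1..length \<eta>}. R b (t (take j \<eta>)))))"
  using assms(1)
proof (induction n arbitrary: P)
  case 0
  from assms(2) obtain u where "u \<in> U" by blast
  then show ?case using 0 by (intro exI[of _ "\<lambda>_. u"]) auto
next
  case (Suc n)
  then obtain s where s: "\<And>i. s i \<in> U" "scattered R B k s"
    "\<And>i. deep_tree R B U k n (\<lambda>b. P b \<and> R b (s i))" by auto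
  from Suc.IH[OF s(3)] obtain t where t: "\<And>i \<eta>. t i \<eta> \<in> U"
    "\<And>i \<eta>. length \<eta> < n \<Longrightarrow> scattered R B k (\<lambda>j. t i (\<eta> @ [j]))"
    "\<And>i \<eta>. length \<eta> \<le> n \<Longrightarrow>
       \<exists>b\<in>B. (P b \<and> R b (s i)) \<and> (\<forall>j\<in>{1..length \<eta>}. R b (t i (take j \<eta>)))"
    by metis
  \<comment> \<open>The root carries no instance, so \<open>s 0\<close> is a dummy label. Each
    \<open>t i\<close> has such a dummy at its own root, which is why the label of the child
    \<open>[i]\<close> comes from \<open>s\<close>.\<close>
  define u where "u = (\<lambda>\<eta>. case \<eta> of [] \<Rightarrow> s 0 | i # \<zeta> \<Rightarrow> if \<zeta> = [] then s i else t i \<zeta>)"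
  have "u \<eta> \<in> U" for \<eta>
    using s(1) t(1) by (auto simp: u_def split: list.split)
  moreover have "scattered R B k (\<lambda>i. u (\<eta> @ [i]))" if "length \<eta> < Suc n" for \<eta>
  proof (cases \<eta>)
    case Nil
    then show ?thesis using s(2) by (simp add: u_def)
  next
    case (Cons i \<zeta>)
    then show ?thesis using t(2)[of \<zeta> i] that by (simp add: u_def)
  qed
  moreover have "\<exists>b\<in>B. P b \<and> (\<forall>j\<in>{1..length \<eta>}. R b (u (take j \<eta>)))"
    if "length \<eta> \<le> Suc n" for \<eta>
  proof (cases \<eta>)
    case Nil
    then show ?thesis using deep_tree_nonempty[OF Suc.prems] by simp
  next
    case (Cons i \<zeta>)
    then obtain b where b: "b \<in> B" "P b" "R b (s i)"
      "\<forall>j\<in>{1..length \<zeta>}. R b (t i (take j \<zeta>))"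
      using t(3)[of \<zeta> i] \<open>length \<eta> \<le> Suc n\<close> by auto
    have "R b (u (take j \<eta>))" if "j \<in> {1..length \<eta>}" for j
    proof (cases "j = 1")
      case True
      then show ?thesis using Cons b by (simp add: u_def)
    next
      case False
      with that obtain j' where j': "j = Suc j'" "j' \<in> {1..length \<zeta>}"
        using Cons by (cases j) auto
      then have "u (take j \<eta>) = t i (take j' \<zeta>)"
        using Cons by (cases \<zeta>) (auto simp: u_def)
      then show ?thesis using b(4) j' by simp
    qed
    then show ?thesis using b by blast
  qed
  ultimately show ?case by blast
qed

section \<open>Thorn-rank and trees of finite depth\<close>

lemma thorn_ge_nonempty:
  "thorn_ge M X Y Z \<Delta> \<Gamma> k \<alpha> \<phi> \<Longrightarrow> \<exists>b\<in>tuples M X. holds M b \<phi>"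
proof (induction rule: thorn_ge.induct)
  case (zero \<alpha> \<phi>)
  then show ?case by (simp add: consistent_finite)
next
  case (limit \<alpha> \<phi>)
  then show ?case unfolding is_limit_def by blast
next
  case (succ \<beta> \<alpha> \<delta> \<pi> c S \<phi>)
  then obtain a where "a \<in> S" by (metis finite.emptyI ex_in_conv)
  then show ?case using succ by (auto simp: holds_And)
qed

text \<open>A positive finite ordinal is neither least nor a limit, so the third rule was applied,
  at the predecessor \<open>N\<close>. The formula \<open>\<pi>\<close> and its parameters disappear
  here, because \<open>S\<close> inherits \<open>k\<close>-inconsistency from the solution set that
  contains it.\<close>

lemma thorn_ge_SucE:
  assumes "thorn_ge M X Y Z \<Delta> \<Gamma> k (enat (Suc N)) \<phi>"
  obtains \<delta> S where "\<delta> \<in> \<Delta>" "S \<subseteq> tuples M Y" "infinite S" "k_inconsistent M X \<delta> k S"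
    "\<And>a. a \<in> S \<Longrightarrow> thorn_ge M X Y Z \<Delta> \<Gamma> k (enat N) (And \<phi> (inst a \<delta>))"
  using assms
proof (cases rule: thorn_ge.cases)
  case zero
  then have "enat (Suc N) \<le> 0" by blast
  then show ?thesis by (simp add: zero_enat_def)
next
  case limit
  then obtain \<gamma> where "enat N < \<gamma>" "\<gamma> < enat (Suc N)"
    unfolding is_limit_def by (metis enat_ord_simps(2) lessI)
  then show ?thesis by (cases \<gamma>) auto
next
  case (succ \<alpha> \<delta> \<pi> c S)
  then obtain a where a: "\<alpha> = enat a" "a < Suc N"
    unfolding is_succ_def by (cases \<alpha>) auto
  have "\<not> a < N" using succ(1) a unfolding is_succ_def
    by (metis enat_ord_simps(1,2) not_less_eq_eq order_refl)
  then have "\<alpha> = enat N" using a by simp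
  moreover have "k_inconsistent M X \<delta> k S"
    using succ unfolding k_inconsistent_def by blast
  moreover have "S \<subseteq> tuples M Y" using succ by (auto simp: solutions_def)
  ultimately show ?thesis using succ that by blast
qed

text \<open>
  The formula \<open>\<delta>\<close> may change from node to node. The bounds \<open>m \<delta>\<close> are lowered one at a time, at
  the formula used at the root, so that a single \<open>\<delta>\<close> can be kept in the end.
\<close>

lemma thorn_ge_deep_tree:
  assumes "finite \<Delta>" and "\<Delta> \<noteq> {}"
  shows "thorn_ge M X Y Z \<Delta> \<Gamma> k (enat N) \<phi> \<Longrightarrow> sum m \<Delta> \<le> N \<Longrightarrow>
    \<exists>\<delta>\<in>\<Delta>. deep_tree (\<lambda>b a. holds M b (inst a \<delta>)) (tuples M X) (tuples M Y) k (m \<delta>)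
      (\<lambda>b. holds M b \<phi>)"
proof (induction N arbitrary: m \<phi>)
  case 0
  then show ?case using assms thorn_ge_nonempty[OF 0(1)] by auto
next
  case (Suc N)
  let ?R = "\<lambda>\<delta> b a. holds M b (inst a \<delta>)"
  let ?T = "\<lambda>\<delta>. deep_tree (?R \<delta>) (tuples M X) (tuples M Y) k"
  show ?case
  proof (cases "\<exists>\<delta>\<in>\<Delta>. m \<delta> = 0")
    case True
    then obtain \<delta> where "\<delta> \<in> \<Delta>" "m \<delta> = 0" by blast
    then show ?thesis
      using thorn_ge_nonempty[OF Suc.prems(1)] by (intro bexI[of _ \<delta>]) simp_all
  next
    case False
    obtain \<delta> S where S: "\<delta> \<in> \<Delta>" "S \<subseteq> tuples M Y"
      "infinite S" "k_inconsistent M X \<delta> k S"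
      "\<And>a. a \<in> S \<Longrightarrow> thorn_ge M X Y Z \<Delta> \<Gamma> k (enat N) (And \<phi> (inst a \<delta>))"
      by (rule thorn_ge_SucE[OF Suc.prems(1)], rule that)
    \<comment> \<open>All bounds are positive in this case, so the sum drops by exactly one, as the
      rank does on passing to the conjunctions with instances of \<open>\<delta>\<close>.\<close>
    define m' where "m' = m(\<delta> := m \<delta> - 1)"
    have "sum m \<Delta> = m \<delta> + sum m (\<Delta> - {\<delta>})" using S(1) assms(1) by (simp add: sum.remove)
    moreover have "sum m' \<Delta> = m' \<delta> + sum m' (\<Delta> - {\<delta>})"
      using S(1) assms(1) by (simp add: sum.remove)
    moreover have "sum m' (\<Delta> - {\<delta>}) = sum m (\<Delta> - {\<delta>})" by (rule sum.cong) (auto simp: m'_def)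
    moreover have m0: "m \<delta> \<noteq> 0" using False S(1) by auto
    ultimately have "sum m' \<Delta> \<le> N" using Suc.prems(2) by (simp add: m'_def)
    then have IH: "\<exists>\<epsilon>\<in>\<Delta>. ?T \<epsilon> (m' \<epsilon>) (\<lambda>b. holds M b (And \<phi> (inst a \<delta>)))" if "a \<in> S" for a
      using Suc.IH S(5) that by blast
    define S' where "S' \<epsilon> = {a \<in> S. ?T \<epsilon> (m' \<epsilon>) (\<lambda>b. holds M b (And \<phi> (inst a \<delta>)))}" for \<epsilon>
    have "S \<subseteq> (\<Union>\<epsilon>\<in>\<Delta>. S' \<epsilon>)" using IH by (auto simp: S'_def)
    \<comment> \<open>Pigeonhole: infinitely many parameters, finitely many formulas.\<close>
    then obtain \<epsilon> where \<epsilon>: "\<epsilon> \<in> \<Delta>" "infinite (S' \<epsilon>)"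
      using S(3) assms(1) by (metis finite_UN finite_subset)
    \<comment> \<open>If \<open>\<epsilon>\<close> differs from \<open>\<delta>\<close>, its bound
      was not lowered and the tree over a single parameter is deep enough. If they are equal, the
      trees are one level short, and a new root whose children are taken from the infinite set
      \<open>S' \<epsilon>\<close> supplies that level.\<close>
    show ?thesis
    proof (cases "\<epsilon> = \<delta>")
      case False
      obtain a where "a \<in> S' \<epsilon>" using \<epsilon>(2) by (metis finite.emptyI ex_in_conv)
      then have "?T \<epsilon> (m \<epsilon>) (\<lambda>b. holds M b (And \<phi> (inst a \<delta>)))"
        using False by (simp add: S'_def m'_def)
      then have "?T \<epsilon> (m \<epsilon>) (\<lambda>b. holds M b \<phi>)"
        by (rule deep_tree_mono) (simp add: holds_And)
      then show ?thesis using \<epsilon>(1) by blast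
    next
      case True
      from infinite_countable_subset[OF \<epsilon>(2)] obtain s :: "nat \<Rightarrow> _"
        where s: "inj s" "range s \<subseteq> S' \<epsilon>" by blast
      have sS: "s i \<in> S" for i using s(2) by (auto simp: S'_def)
      have "k_inconsistent_seq M X \<delta> k s"
        unfolding k_inconsistent_seq_def
      proof (intro allI impI)
        fix I :: "nat set" assume I: "finite I \<and> card I = k"
        have "card (s ` I) = k" using I s(1) by (metis card_image inj_on_subset subset_UNIV)
        moreover have "s ` I \<subseteq> S" using sS by blast
        ultimately have "\<not> consistent M X ((\<lambda>a. inst a \<delta>) ` (s ` I))"
          using S(4) I unfolding k_inconsistent_def by blast
        then show "\<not> consistent M X ((\<lambda>i. inst (s i) \<delta>) ` I)" by (simp add: image_image)
      qed
      then have "scattered (?R \<delta>) (tuples M X) k s"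
        by (simp add: k_inconsistent_seq_iff_scattered)
      moreover have "?T \<delta> (m' \<delta>) (\<lambda>b. holds M b \<phi> \<and> ?R \<delta> b (s i))" for i
        using s(2) True by (auto simp: S'_def holds_And[abs_def])
      moreover have "s i \<in> tuples M Y" for i using sS S(2) by blast
      ultimately have "?T \<delta> (Suc (m' \<delta>)) (\<lambda>b. holds M b \<phi>)"
        unfolding deep_tree.simps by blast
      then show ?thesis using S(1) m0 by (auto simp: m'_def)
    qed
  qed
qed

lemma infinite_thorn_rank_imp_deep_trees:
  assumes "thorn_rank M X Y Z \<Delta> \<Gamma> k \<phi> = \<infinity>" and "finite \<Delta>"
  shows "\<exists>\<delta>\<in>\<Delta>. \<forall>n. deep_tree (\<lambda>b a. holds M b (inst a \<delta>)) (tuples M X) (tuples M Y) k n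
    (\<lambda>b. holds M b \<phi>)"
proof -
  \<comment> \<open>The supremum is approached by finite values or attained at
    \<open>\<infinity>\<close>. Having no predecessor, \<open>\<infinity>\<close> can only be
    reached by the limit rule, which yields every finite value.\<close>
  have large: "\<exists>N\<ge>n. thorn_ge M X Y Z \<Delta> \<Gamma> k (enat N) \<phi>" for n
  proof -
    have "enat n < Sup {\<alpha>. thorn_ge M X Y Z \<Delta> \<Gamma> k \<alpha> \<phi>}"
      using assms(1) by (simp add: thorn_rank_def)
    then obtain \<alpha> where \<alpha>: "thorn_ge M X Y Z \<Delta> \<Gamma> k \<alpha> \<phi>" "enat n < \<alpha>"
      by (auto simp: less_Sup_iff)
    show ?thesis
    proof (cases \<alpha>)
      case (enat N)
      then show ?thesis using \<alpha> by (auto intro!: exI[of _ N])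
    next
      case infinity
      from \<alpha>(1) show ?thesis
      proof (cases rule: thorn_ge.cases)
        case zero
        then have "\<alpha> \<le> 0" by blast
        then show ?thesis using \<alpha>(2) by simp
      next
        case limit
        then have "thorn_ge M X Y Z \<Delta> \<Gamma> k (enat n) \<phi>" using \<alpha>(2) by simp
        then show ?thesis by blast
      next
        case (succ \<beta>)
        then obtain j where "\<beta> = enat j" using infinity unfolding is_succ_def by (cases \<beta>) auto
        then have "\<infinity> \<le> enat (Suc j)"
          using succ(1) infinity unfolding is_succ_def by (metis enat_ord_simps(2) lessI)
        then show ?thesis by simp
      qed
    qed
  qed
  obtain N0 where N0: "N0 \<ge> 1" "thorn_ge M X Y Z \<Delta> \<Gamma> k (enat N0) \<phi>" using large by blast
  then have "thorn_ge M X Y Z \<Delta> \<Gamma> k (enat (Suc (N0 - 1))) \<phi>" by simp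
  \<comment> \<open>A rank of at least one comes from the successor rule, which names a member of
    \<open>\<Delta>\<close>.\<close>
  then have ne: "\<Delta> \<noteq> {}" by (rule thorn_ge_SucE) auto
  let ?Q = "\<lambda>\<delta> n. deep_tree (\<lambda>b a. holds M b (inst a \<delta>)) (tuples M X) (tuples M Y) k n
    (\<lambda>b. holds M b \<phi>)"
  have ex: "\<exists>\<delta>\<in>\<Delta>. ?Q \<delta> n" for n
  proof -
    obtain N where "sum (\<lambda>_. n) \<Delta> \<le> N" "thorn_ge M X Y Z \<Delta> \<Gamma> k (enat N) \<phi>" using large by blast
    then show ?thesis using thorn_ge_deep_tree[OF assms(2) ne, where m = "\<lambda>_. n"] by blast
  qed
  \<comment> \<open>So far the formula depends on the depth. If every \<open>\<delta>\<close> failed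
    at some depth \<open>f \<delta>\<close>, then none could have a tree of depth
    \<open>sum f \<Delta>\<close>, since trees can be truncated.\<close>
  show ?thesis
  proof (rule ccontr)
    assume "\<not> ?thesis"
    then obtain f where f: "\<And>\<delta>. \<delta> \<in> \<Delta> \<Longrightarrow> \<not> ?Q \<delta> (f \<delta>)" by metis
    obtain \<delta> where \<delta>: "\<delta> \<in> \<Delta>" "?Q \<delta> (sum f \<Delta>)" using ex by blast
    have "f \<delta> \<le> sum f \<Delta>" by (rule member_le_sum) (use \<delta>(1) assms(2) in auto)
    then show False using f[OF \<delta>(1)] deep_tree_antimono[OF \<delta>(2)] by blast
  qed
qed

section \<open>Definable predicates in a one-sorted structure\<close>

text \<open>Substitution is written out for terms only. For formulas, where bound variables get in
  the way, \<open>definable_subst\<close> asserts just the existence of a formula with the right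
  meaning.\<close>

primrec subst_tm ::
  "('v \<times> 's \<Rightarrow> ('w, 's, 'f) tm) \<Rightarrow> ('v, 's, 'f) tm \<Rightarrow> ('w, 's, 'f) tm" where
  "subst_tm \<tau> (Var x) = \<tau> x"
| "subst_tm \<tau> (Fn f ts) = Fn f (map (subst_tm \<tau>) ts)"

lemma tm_val_subst_tm: "tm_val M v (subst_tm \<tau> t) = tm_val M (\<lambda>x. tm_val M v (\<tau> x)) t"
proof (induction t)
  case (Fn f ts)
  then have "map (tm_val M v) (map (subst_tm \<tau>) ts) = map (tm_val M (\<lambda>x. tm_val M v (\<tau> x))) ts"
    by auto
  then show ?case by (simp only: subst_tm.simps tm_val.simps)
qed simp

lemma tm_val_comp_subst_tm: "tm_val M v \<circ> subst_tm \<tau> = tm_val M (\<lambda>x. tm_val M v (\<tau> x))"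
  by (auto simp: tm_val_subst_tm)

lemma tm_vars_subst_tm: "tm_vars (subst_tm \<tau> t) = (\<Union>x\<in>tm_vars t. tm_vars (\<tau> x))"
  by (induction t) auto

text \<open>With a single sort, an argument list is well-sorted as soon as it has the right
  length.\<close>

lemma unit_list_eq_iff: "xs = ys \<longleftrightarrow> length xs = length ys" for xs ys :: "unit list"
  by (metis (full_types) old.unit.exhaust nth_equalityI)

lemma finite_tm_vars: "finite (tm_vars t)"
  by (induction t) auto

lemma finite_free_vars: "finite (free_vars \<phi>)"
  by (induction \<phi>) (auto simp: finite_tm_vars)

lemma free_vars_foldr_Ex: "free_vars (foldr Ex xs \<phi>) = free_vars \<phi> - set xs"
  by (induction xs) auto

locale one_sorted_struct =
  fixes L :: "(unit, 'f, 'r) lang" and M :: "(unit, 'f, 'r, 'e) struct"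
  assumes Sorts_UNIV: "Sorts L = UNIV"
    and is_struct: "is_struct L M"
begin

lemma univ_nonempty: "univ M \<noteq> {}"
  using is_struct Sorts_UNIV by (auto simp: is_struct_def)

definition vals :: "(nat \<times> unit \<Rightarrow> 'e) set" where
  "vals = {v. \<forall>x. v x \<in> univ M}"

lemma vals_app: "v \<in> vals \<Longrightarrow> v x \<in> univ M"
  unfolding vals_def by blast

lemma vals_upd: "v \<in> vals \<Longrightarrow> a \<in> univ M \<Longrightarrow> v(x := a) \<in> vals"
  by (auto simp: vals_def)

lemma wf_tm_subst_tm:
  "wf_tm L t \<Longrightarrow> (\<And>x. x \<in> tm_vars t \<Longrightarrow> wf_tm L (\<tau> x)) \<Longrightarrow> wf_tm L (subst_tm \<tau> t)"
proof (induction t)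
  case (Fn f ts)
  then have "map (tm_sort L) (map (subst_tm \<tau>) ts) = fdom L f"
    by (metis length_map unit_list_eq_iff wf_tm.simps(2))
  with Fn show ?case by auto
qed simp

lemma tm_val_in_univ: "wf_tm L t \<Longrightarrow> v \<in> vals \<Longrightarrow> tm_val M v t \<in> univ M"
proof (induction t)
  case (Fn f ts)
  have "map (srt M) (map (tm_val M v) ts) = fdom L f"
    using Fn.prems(1) by (metis length_map unit_list_eq_iff wf_tm.simps(2))
  moreover have "set (map (tm_val M v) ts) \<subseteq> univ M" using Fn by auto
  ultimately show ?case using is_struct Fn.prems(1) by (auto simp: is_struct_def)
qed (simp add: vals_app)

lemma wf_fm_foldr_Ex: "wf_fm L (foldr Ex xs \<phi>) \<longleftrightarrow> wf_fm L \<phi>"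
  using Sorts_UNIV by (induction xs) auto

lemma sat_foldr_Ex:
  "v \<in> vals \<Longrightarrow> sat M v (foldr Ex xs \<phi>)
     \<longleftrightarrow> (\<exists>w\<in>vals. (\<forall>x. x \<notin> set xs \<longrightarrow> w x = v x) \<and> sat M w \<phi>)"
proof (induction xs arbitrary: v)
  case Nil
  have "w = v" if "\<forall>x. w x = v x" for w using that by blast
  then show ?case using Nil by auto
next
  case (Cons y xs)
  have "sat M v (foldr Ex (y # xs) \<phi>) \<longleftrightarrow> (\<exists>a\<in>univ M. sat M (v(y := a)) (foldr Ex xs \<phi>))"
    by simp
  also have "\<dots> \<longleftrightarrow> (\<exists>a\<in>univ M. \<exists>w\<in>vals. (\<forall>x. x \<notin> set xs \<longrightarrow> w x = (v(y := a)) x) \<and> sat M w \<phi>)"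
    using Cons.IH vals_upd[OF Cons.prems] by blast
  also have "\<dots> \<longleftrightarrow> (\<exists>w\<in>vals. (\<forall>x. x \<notin> set (y # xs) \<longrightarrow> w x = v x) \<and> sat M w \<phi>)"
  proof
    assume "\<exists>a\<in>univ M. \<exists>w\<in>vals. (\<forall>x. x \<notin> set xs \<longrightarrow> w x = (v(y := a)) x) \<and> sat M w \<phi>"
    then show "\<exists>w\<in>vals. (\<forall>x. x \<notin> set (y # xs) \<longrightarrow> w x = v x) \<and> sat M w \<phi>"
      by (elim bexE, intro bexI) auto
  next
    assume "\<exists>w\<in>vals. (\<forall>x. x \<notin> set (y # xs) \<longrightarrow> w x = v x) \<and> sat M w \<phi>"
    then obtain w where w: "w \<in> vals" "\<forall>x. x \<notin> set (y # xs) \<longrightarrow> w x = v x" "sat M w \<phi>" by blast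
    then have "w y \<in> univ M" "\<forall>x. x \<notin> set xs \<longrightarrow> w x = (v(y := w y)) x"
      using vals_app by auto
    then show "\<exists>a\<in>univ M. \<exists>w\<in>vals. (\<forall>x. x \<notin> set xs \<longrightarrow> w x = (v(y := a)) x) \<and> sat M w \<phi>"
      using w by blast
  qed
  finally show ?case .
qed

text \<open>Formulas are handled through their meaning: closure properties of definable predicates
  replace explicit formulas. Only valuations into the universe are compared, because quantifiers
  range over it. \<open>W\<close> records the variables on which the predicate may depend, which is
  needed when some of them are quantified away.\<close>

definition definable :: "(nat \<times> unit) set \<Rightarrow> ((nat \<times> unit \<Rightarrow> 'e) \<Rightarrow> bool) \<Rightarrow> bool" where
  "definable W P \<longleftrightarrow> (\<exists>\<phi>\<in>Form L W. \<forall>v\<in>vals. sat M v \<phi> \<longleftrightarrow> P v)"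

lemma definableI:
  "wf_fm L \<phi> \<Longrightarrow> free_vars \<phi> \<subseteq> W \<Longrightarrow> (\<And>v. v \<in> vals \<Longrightarrow> sat M v \<phi> \<longleftrightarrow> P v) \<Longrightarrow> definable W P"
  unfolding definable_def Form_def by blast

lemma definableE:
  assumes "definable W P"
  obtains \<phi> where "wf_fm L \<phi>" "free_vars \<phi> \<subseteq> W" "\<And>v. v \<in> vals \<Longrightarrow> sat M v \<phi> \<longleftrightarrow> P v"
  using assms unfolding definable_def Form_def by blast

lemma definable_cong:
  assumes "definable W P" "\<And>v. v \<in> vals \<Longrightarrow> P v \<longleftrightarrow> Q v" "W \<subseteq> W'"
  shows "definable W' Q"
  using assms(1) by (rule definableE) (rule definableI; use assms in auto)

lemma definable_Not: "definable W P \<Longrightarrow> definable W (\<lambda>v. \<not> P v)"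
  by (erule definableE) (rule definableI[of "Neg _"]; auto)

lemma definable_conj:
  assumes "definable W P" "definable W Q"
  shows "definable W (\<lambda>v. P v \<and> Q v)"
proof -
  from assms(1) obtain \<phi> where "wf_fm L \<phi>" "free_vars \<phi> \<subseteq> W" "\<And>v. v \<in> vals \<Longrightarrow> sat M v \<phi> \<longleftrightarrow> P v"
    by (rule definableE) blast
  moreover from assms(2) obtain \<psi> where
    "wf_fm L \<psi>" "free_vars \<psi> \<subseteq> W" "\<And>v. v \<in> vals \<Longrightarrow> sat M v \<psi> \<longleftrightarrow> Q v"
    by (rule definableE) blast
  ultimately show ?thesis by (intro definableI[of "And \<phi> \<psi>"]) auto
qed

lemma definable_True: "definable W (\<lambda>_. True)"
  \<comment> \<open>\<open>W\<close> may be empty, so the true formula has to be a sentence.\<close>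
  by (rule definableI[of "Neg (Ex (0, ()) (Neg (Eq (Var (0, ())) (Var (0, ())))))"])
    (auto simp: Sorts_UNIV)

lemma definable_ball:
  "finite I \<Longrightarrow> (\<And>i. i \<in> I \<Longrightarrow> definable W (P i)) \<Longrightarrow> definable W (\<lambda>v. \<forall>i\<in>I. P i v)"
proof (induction I rule: finite_induct)
  case empty
  then show ?case using definable_True by simp
next
  case (insert i I)
  then have "definable W (\<lambda>v. P i v \<and> (\<forall>i\<in>I. P i v))" by (intro definable_conj) auto
  then show ?case by simp
qed

lemma definable_ex:
  assumes "definable (W \<union> V) P" and "finite V"
  shows "definable W (\<lambda>v. \<exists>w\<in>vals. (\<forall>x. x \<notin> V \<longrightarrow> w x = v x) \<and> P w)"
proof -
  obtain xs where xs: "set xs = V" using finite_list[OF assms(2)] by blast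
  from assms(1) show ?thesis
  proof (rule definableE)
    fix \<phi> assume "wf_fm L \<phi>" "free_vars \<phi> \<subseteq> W \<union> V" "\<And>v. v \<in> vals \<Longrightarrow> sat M v \<phi> \<longleftrightarrow> P v"
    then show ?thesis
      by (intro definableI[of "foldr Ex xs \<phi>"])
        (auto simp: wf_fm_foldr_Ex free_vars_foldr_Ex sat_foldr_Ex xs)
  qed
qed

lemma ex_fresh_var: "finite W \<Longrightarrow> \<exists>z :: nat \<times> unit. z \<notin> W"
  by (rule ex_new_if_finite) (auto simp: finite_prod)

lemma definable_subst:
  fixes \<tau> :: "'v \<times> unit \<Rightarrow> (nat, unit, 'f) tm"
  assumes "wf_fm L \<phi>" and "\<And>x. x \<in> free_vars \<phi> \<Longrightarrow> wf_tm L (\<tau> x)"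
  shows "definable (\<Union>x\<in>free_vars \<phi>. tm_vars (\<tau> x)) (\<lambda>v. sat M (\<lambda>x. tm_val M v (\<tau> x)) \<phi>)"
  using assms
proof (induction \<phi> arbitrary: \<tau>)
  case (Eq t u)
  then show ?case
    by (intro definableI[of "Eq (subst_tm \<tau> t) (subst_tm \<tau> u)"])
      (auto simp: tm_val_subst_tm tm_vars_subst_tm intro!: wf_tm_subst_tm)
next
  case (Rel r ts)
  have "map (tm_sort L) (map (subst_tm \<tau>) ts) = rdom L r"
    using Rel.prems(1) by (metis length_map unit_list_eq_iff wf_fm.simps(2))
  then show ?case using Rel.prems
    by (intro definableI[of "Rel r (map (subst_tm \<tau>) ts)"])
      (auto simp: tm_vars_subst_tm tm_val_comp_subst_tm intro!: wf_tm_subst_tm)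
next
  case (Neg \<phi>)
  have "definable (\<Union>x\<in>free_vars \<phi>. tm_vars (\<tau> x)) (\<lambda>v. \<not> sat M (\<lambda>x. tm_val M v (\<tau> x)) \<phi>)"
    by (rule definable_Not, rule Neg.IH) (use Neg.prems in auto)
  then show ?case by simp
next
  case (And \<phi> \<psi>)
  let ?W = "\<Union>x\<in>free_vars (And \<phi> \<psi>). tm_vars (\<tau> x)"
  have "definable ?W (\<lambda>v. sat M (\<lambda>x. tm_val M v (\<tau> x)) \<phi>)"
    by (rule definable_cong, rule And.IH(1)) (use And.prems in auto)
  moreover have "definable ?W (\<lambda>v. sat M (\<lambda>x. tm_val M v (\<tau> x)) \<psi>)"
    by (rule definable_cong, rule And.IH(2)) (use And.prems in auto)
  ultimately show ?case by (simp only: sat.simps) (rule definable_conj)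
next
  case (Ex x \<phi>)
  let ?W = "\<Union>y\<in>free_vars (Ex x \<phi>). tm_vars (\<tau> y)"
  have "finite ?W" by (auto simp: finite_free_vars finite_tm_vars)
  \<comment> \<open>The bound variable is renamed to a \<open>z\<close> that does not occur in the
    terms substituted for the other free variables, so nothing is captured.\<close>
  then obtain z where z: "z \<notin> ?W" using ex_fresh_var by blast
  let ?\<tau> = "\<tau>(x := Var z)"
  have "definable (?W \<union> {z}) (\<lambda>v. sat M (\<lambda>y. tm_val M v (?\<tau> y)) \<phi>)"
    by (rule definable_cong, rule Ex.IH[of ?\<tau>])
      (use Ex.prems Sorts_UNIV in \<open>auto split: if_splits\<close>)
  then have "definable ?W (\<lambda>v. \<exists>w\<in>vals. (\<forall>y. y \<notin> {z} \<longrightarrow> w y = v y)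
      \<and> sat M (\<lambda>y. tm_val M w (?\<tau> y)) \<phi>)"
    by (rule definable_ex) simp
  then show ?case
  proof (rule definable_cong)
    fix v assume v: "v \<in> vals"
    have eq: "sat M (\<lambda>y. tm_val M (v(z := a)) (?\<tau> y)) \<phi>
        \<longleftrightarrow> sat M ((\<lambda>y. tm_val M v (\<tau> y))(x := a)) \<phi>" for a
    proof (rule sat_cong)
      fix y assume "y \<in> free_vars \<phi>"
      then show "tm_val M (v(z := a)) (?\<tau> y) = ((\<lambda>y. tm_val M v (\<tau> y))(x := a)) y"
        using z by (cases "y = x") (auto intro!: tm_val_cong)
    qed
    have "(\<exists>w\<in>vals. (\<forall>y. y \<notin> {z} \<longrightarrow> w y = v y) \<and> sat M (\<lambda>y. tm_val M w (?\<tau> y)) \<phi>)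
      \<longleftrightarrow> (\<exists>a\<in>univ M. sat M (\<lambda>y. tm_val M (v(z := a)) (?\<tau> y)) \<phi>)"
    proof
      assume "\<exists>w\<in>vals. (\<forall>y. y \<notin> {z} \<longrightarrow> w y = v y) \<and> sat M (\<lambda>y. tm_val M w (?\<tau> y)) \<phi>"
      then obtain w where w: "w \<in> vals" "\<forall>y. y \<notin> {z} \<longrightarrow> w y = v y"
        "sat M (\<lambda>y. tm_val M w (?\<tau> y)) \<phi>" by blast
      then have "v(z := w z) = w" "w z \<in> univ M" using vals_app by auto
      then show "\<exists>a\<in>univ M. sat M (\<lambda>y. tm_val M (v(z := a)) (?\<tau> y)) \<phi>"
        using w(3) by (intro bexI[of _ "w z"]) simp_all
    next
      assume "\<exists>a\<in>univ M. sat M (\<lambda>y. tm_val M (v(z := a)) (?\<tau> y)) \<phi>"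
      then obtain a where a: "a \<in> univ M" "sat M (\<lambda>y. tm_val M (v(z := a)) (?\<tau> y)) \<phi>" by blast
      show "\<exists>w\<in>vals. (\<forall>y. y \<notin> {z} \<longrightarrow> w y = v y) \<and> sat M (\<lambda>y. tm_val M w (?\<tau> y)) \<phi>"
        by (rule bexI[of _ "v(z := a)"]) (use a v vals_upd in auto)
    qed
    then show "(\<exists>w\<in>vals. (\<forall>y. y \<notin> {z} \<longrightarrow> w y = v y) \<and> sat M (\<lambda>y. tm_val M w (?\<tau> y)) \<phi>)
      \<longleftrightarrow> sat M (\<lambda>y. tm_val M v (\<tau> y)) (Ex x \<phi>)"
      using eq by simp
  qed (rule order_refl)
qed

section \<open>Compactness in a saturated structure\<close>

lemma wf_tm_inst_tm: "wf_tm L t \<Longrightarrow> ran a \<subseteq> A \<Longrightarrow> wf_tm (par_lang L M A) (inst_tm a t)"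
proof (induction t)
  case (Var x)
  then have "e \<in> A" if "a x = Some e" for e using that by (auto intro: ranI)
  then show ?case by (simp add: par_lang_def Sorts_UNIV split: option.split)
next
  case (Fn f ts)
  have "map (tm_sort (par_lang L M A)) (map (inst_tm a) ts) = fdom L f"
    using Fn.prems(1) by (metis length_map unit_list_eq_iff wf_tm.simps(2))
  with Fn show ?case by (auto simp: par_lang_def)
qed

lemma wf_fm_inst: "wf_fm L \<phi> \<Longrightarrow> ran a \<subseteq> A \<Longrightarrow> wf_fm (par_lang L M A) (inst a \<phi>)"
proof (induction \<phi> arbitrary: a)
  case (Rel r ts)
  have "map (tm_sort (par_lang L M A)) (map (inst_tm a) ts) = rdom L r"
    using Rel.prems(1) by (metis length_map unit_list_eq_iff wf_fm.simps(2))
  with Rel show ?case by (auto simp: par_lang_def wf_tm_inst_tm[unfolded par_lang_def])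
next
  case (Ex x \<phi>)
  have "ran (a(x := None)) \<subseteq> A" using Ex.prems(2) by (auto simp: ran_def split: if_splits)
  then show ?case using Ex by (simp add: par_lang_def Sorts_UNIV)
qed (auto simp: wf_tm_inst_tm)

lemma tm_vars_inst_tm: "tm_vars (inst_tm a t) = tm_vars t - dom a"
  by (induction t) (auto split: option.split)

lemma free_vars_inst: "free_vars (inst a \<phi>) = free_vars \<phi> - dom a"
  by (induction \<phi> arbitrary: a) (auto simp: tm_vars_inst_tm)

lemma inst_in_PForm:
  assumes "wf_fm L \<phi>" "free_vars \<phi> \<subseteq> X \<union> dom a" "ran a \<subseteq> A"
  shows "inst a \<phi> \<in> PForm L M A X"
  using assms wf_fm_inst by (auto simp: PForm_def Form_def free_vars_inst)

text \<open>Every finite part of \<open>\<Sigma>\<close> is reduced to its consequence for the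
  variables up to the next one by quantifying the later variables away. With the values
  \<open>s\<close> put in for the earlier variables, these consequences form a type in one variable
  over a finite set, and saturation realises it.\<close>

lemma one_variable_extension:
  assumes sat: "saturated L M" and inf: "infinite (univ M)"
    and wf: "\<Sigma> \<subseteq> {\<phi>. wf_fm L \<phi>}"
    and s: "set s \<subseteq> univ M"
    and fin: "\<And>q. q \<subseteq> \<Sigma> \<Longrightarrow> finite q \<Longrightarrow>
      \<exists>v\<in>vals. (\<forall>i<length s. v (i, ()) = s ! i) \<and> (\<forall>\<phi>\<in>q. sat M v \<phi>)"
  shows "\<exists>e\<in>univ M. \<forall>q. q \<subseteq> \<Sigma> \<and> finite q \<longrightarrow>
      (\<exists>v\<in>vals. (\<forall>i<Suc (length s). v (i, ()) = (s @ [e]) ! i) \<and> (\<forall>\<phi>\<in>q. sat M v \<phi>))"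
proof -
  define n where "n = length s"
  define x where "x = (n, ())"
  obtain d where d: "d \<in> univ M" using univ_nonempty by blast
  define a :: "nat \<times> unit \<Rightarrow> 'e option" where
    "a = (\<lambda>y. if fst y < n then Some (s ! fst y) else None)"
  \<comment> \<open>The value \<open>d\<close> at later variables is arbitrary; the formulas
    \<open>\<psi> q\<close> do not mention them.\<close>
  define u where "u e y = (if fst y < n then s ! fst y else if fst y = n then e else d)"
    for e and y :: "nat \<times> unit"
  have u: "u e \<in> vals" if "e \<in> univ M" for e
    using that s d by (auto simp: vals_def u_def n_def nth_mem subset_iff)
  define V where "V q = (\<Union>\<phi>\<in>q. free_vars \<phi>) - {..n} \<times> UNIV"
    for q :: "(nat, unit, 'f, 'r) fm set"
  define P where "P q v \<longleftrightarrow> (\<exists>w\<in>vals. (\<forall>y. y \<notin> V q \<longrightarrow> w y = v y) \<and> (\<forall>\<phi>\<in>q. sat M w \<phi>))" for q v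
  have "definable ({..n} \<times> UNIV) (P q)" if q: "q \<subseteq> \<Sigma>" "finite q" for q
    unfolding P_def
  proof (rule definable_ex)
    show "finite (V q)" using q(2) by (auto simp: V_def finite_free_vars)
    show "definable ({..n} \<times> UNIV \<union> V q) (\<lambda>w. \<forall>\<phi>\<in>q. sat M w \<phi>)"
    proof (rule definable_ball[OF q(2)])
      fix \<phi> assume "\<phi> \<in> q"
      then show "definable ({..n} \<times> UNIV \<union> V q) (\<lambda>w. sat M w \<phi>)"
        by (intro definableI[of \<phi>]) (use wf q(1) in \<open>auto simp: V_def\<close>)
    qed
  qed
  then have "\<forall>q. \<exists>\<psi>. q \<subseteq> \<Sigma> \<and> finite q \<longrightarrow> wf_fm L \<psi> \<and> free_vars \<psi> \<subseteq> {..n} \<times> UNIV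
      \<and> (\<forall>v\<in>vals. sat M v \<psi> \<longleftrightarrow> P q v)"
    unfolding definable_def Form_def by blast
  then obtain \<psi> where \<psi>: "\<And>q. q \<subseteq> \<Sigma> \<Longrightarrow> finite q \<Longrightarrow> wf_fm L (\<psi> q)"
    "\<And>q. q \<subseteq> \<Sigma> \<Longrightarrow> finite q \<Longrightarrow> free_vars (\<psi> q) \<subseteq> {..n} \<times> UNIV"
    "\<And>q v. q \<subseteq> \<Sigma> \<Longrightarrow> finite q \<Longrightarrow> v \<in> vals \<Longrightarrow> sat M v (\<psi> q) \<longleftrightarrow> P q v"
    by metis
  have holds: "holds M [x \<mapsto> e] (inst a (\<psi> q)) \<longleftrightarrow> P q (u e)"
    if "q \<subseteq> \<Sigma>" "finite q" "e \<in> univ M" for q e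
  proof -
    have "sat M (\<lambda>y. the (([x \<mapsto> e] ++ a) y)) (\<psi> q) \<longleftrightarrow> sat M (u e) (\<psi> q)"
    proof (rule sat_cong)
      fix y assume "y \<in> free_vars (\<psi> q)"
      then have "fst y \<le> n" using \<psi>(2)[OF that(1,2)] by auto
      moreover have "y = x" if "fst y = n" using that by (cases y) (simp add: x_def)
      ultimately show "the (([x \<mapsto> e] ++ a) y) = u e y"
        by (auto simp: map_add_def a_def u_def x_def)
    qed
    then show ?thesis using \<psi>(3)[OF that(1,2) u[OF that(3)]] by (simp add: holds_inst)
  qed
  have tuples: "[x \<mapsto> e] \<in> tuples M {x}" if "e \<in> univ M" for e
    using that by (auto simp: tuples_def)
  define Q where "Q = {q. q \<subseteq> \<Sigma> \<and> finite q}"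
  define p where "p = (\<lambda>q. inst a (\<psi> q)) ` Q"
  have "ran a \<subseteq> set s" by (auto simp: ran_def a_def n_def split: if_splits)
  moreover have "free_vars (\<psi> q) \<subseteq> {x} \<union> dom a" if "q \<in> Q" for q
  proof
    fix y assume "y \<in> free_vars (\<psi> q)"
    then have "fst y \<le> n" using \<psi>(2)[of q] that by (auto simp: Q_def)
    moreover have "y = x" if "fst y = n" using that by (cases y) (simp add: x_def)
    ultimately show "y \<in> {x} \<union> dom a" by (cases "fst y < n") (auto simp: a_def dom_def)
  qed
  ultimately have "p \<subseteq> PForm L M (set s) {x}"
    using \<psi>(1) by (auto simp: p_def Q_def intro!: inst_in_PForm)
  moreover have "small M (set s)"
    using s inf by (simp add: small_def finite_lesspoll_infinite)
  moreover have "consistent M {x} p"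
    unfolding consistent_def
  proof (intro allI impI)
    fix q assume "q \<subseteq> p \<and> finite q"
    then obtain Q' where Q': "Q' \<subseteq> Q" "finite Q'" "q = (\<lambda>q. inst a (\<psi> q)) ` Q'"
      unfolding p_def by (meson finite_subset_image)
    \<comment> \<open>Finitely many finite parts have a finite union, so one valuation serves them
      all.\<close>
    then have "\<Union>Q' \<subseteq> \<Sigma>" "finite (\<Union>Q')" by (auto simp: Q_def)
    from fin[OF this] obtain v where v: "v \<in> vals" "\<forall>i<length s. v (i, ()) = s ! i"
      "\<forall>\<phi>\<in>\<Union>Q'. sat M v \<phi>" by blast
    have e: "v x \<in> univ M" using v(1) by (rule vals_app)
    have uv: "u (v x) y = v y" if "fst y \<le> n" for y
      using that v(2) by (cases y) (auto simp: u_def n_def x_def)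
    have "P q' (u (v x))" if q': "q' \<in> Q'" for q'
    proof -
      \<comment> \<open>\<open>P\<close> only allows changes on \<open>V q'\<close>, while
        \<open>v\<close> and \<open>u (v x)\<close> may differ at any later variable. Hence
        \<open>v\<close> is copied on \<open>V q'\<close> alone, which covers the later variables
        that occur in \<open>q'\<close>.\<close>
      define w where "w y = (if y \<in> V q' then v y else u (v x) y)" for y
      have "w \<in> vals" using v(1) u[OF e] unfolding w_def vals_def by simp
      moreover have "sat M w \<phi>" if "\<phi> \<in> q'" for \<phi>
      proof -
        have "sat M w \<phi> \<longleftrightarrow> sat M v \<phi>"
        proof (rule sat_cong)
          fix y assume "y \<in> free_vars \<phi>"
          then have "y \<in> V q' \<or> fst y \<le> n" using that by (cases y) (auto simp: V_def)
          then show "w y = v y" using uv[of y] by (auto simp: w_def)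
        qed
        then show ?thesis using v(3) q' that by blast
      qed
      moreover have "\<forall>y. y \<notin> V q' \<longrightarrow> w y = u (v x) y" by (simp add: w_def)
      ultimately show ?thesis unfolding P_def by blast
    qed
    then have "\<forall>q'\<in>Q'. holds M [x \<mapsto> v x] (inst a (\<psi> q'))"
      using holds e Q'(1) by (auto simp: Q_def)
    then show "\<exists>b\<in>tuples M {x}. \<forall>\<phi>\<in>q. holds M b \<phi>" using tuples[OF e] Q'(3) by blast
  qed
  ultimately have "realisations M {x} p \<noteq> {}" using sat unfolding saturated_def by blast
  then obtain b where b: "b \<in> tuples M {x}" "\<forall>\<phi>\<in>p. holds M b \<phi>"
    by (auto simp: realisations_def)
  obtain e where be: "b = [x \<mapsto> e]" using b(1) unfolding tuples_def
    by (auto simp: dom_eq_singleton_conv)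
  then have e: "e \<in> univ M" using tuples_Some[OF b(1), of x e] by simp
  show ?thesis
  proof (intro bexI[OF _ e] allI impI)
    fix q assume q: "q \<subseteq> \<Sigma> \<and> finite q"
    then have "inst a (\<psi> q) \<in> p" by (simp add: p_def Q_def)
    then have "P q (u e)" using b(2) holds[of q e] q e be by simp
    then obtain w where w: "w \<in> vals" "\<forall>y. y \<notin> V q \<longrightarrow> w y = u e y" "\<forall>\<phi>\<in>q. sat M w \<phi>"
      unfolding P_def by blast
    have "w (i, ()) = (s @ [e]) ! i" if "i < Suc (length s)" for i
    proof -
      have "(i, ()) \<notin> V q" using that by (simp add: V_def n_def)
      then have "w (i, ()) = u e (i, ())" using w(2) by blast
      then show ?thesis using that by (auto simp: u_def n_def nth_append)
    qed
    then show "\<exists>v\<in>vals. (\<forall>i<Suc (length s). v (i, ()) = (s @ [e]) ! i) \<and> (\<forall>\<phi>\<in>q. sat M v \<phi>)"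
      using w by blast
  qed
qed

text \<open>The variables are countably many and are given values one at a time, keeping
  \<open>\<Sigma>\<close> finitely satisfiable. In the limit each formula holds because its finitely
  many variables have received their values at some finite stage. Saturation bounds the size of the
  parameter set and not the number of formulas, so \<open>\<Sigma>\<close> may have any
  cardinality.\<close>

theorem countable_compactness:
  assumes sat: "saturated L M" and inf: "infinite (univ M)"
    and wf: "\<Sigma> \<subseteq> {\<phi>. wf_fm L \<phi>}"
    and fin: "\<And>q. q \<subseteq> \<Sigma> \<Longrightarrow> finite q \<Longrightarrow> \<exists>v\<in>vals. \<forall>\<phi>\<in>q. sat M v \<phi>"
  shows "\<exists>v\<in>vals. \<forall>\<phi>\<in>\<Sigma>. sat M v \<phi>"
proof -
  define FS where "FS s \<longleftrightarrow> set s \<subseteq> univ M \<and> (\<forall>q. q \<subseteq> \<Sigma> \<and> finite q \<longrightarrow>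
      (\<exists>v\<in>vals. (\<forall>i<length s. v (i, ()) = s ! i) \<and> (\<forall>\<phi>\<in>q. sat M v \<phi>)))" for s
  have "\<exists>e. FS (s @ [e])" if "FS s" for s
    using one_variable_extension[OF sat inf wf, of s] that unfolding FS_def by auto
  then obtain f where f: "\<And>s. FS s \<Longrightarrow> FS (s @ [f s])" by metis
  define S where "S = rec_nat [] (\<lambda>_ s. s @ [f s])"
  have S_Suc: "S (Suc n) = S n @ [f (S n)]" for n by (simp add: S_def)
  have len: "length (S n) = n" for n
    by (induction n) (simp_all add: S_Suc, simp add: S_def)
  have FS: "FS (S n)" for n
  proof (induction n)
    case 0
    then show ?case using fin by (simp add: S_def FS_def)
  next
    case (Suc n)
    then show ?case using f S_Suc by simp
  qed
  have nth: "S m ! i = S (Suc i) ! i" if "i < m" for i m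
    using that
  proof (induction m)
    case (Suc m)
    show ?case
    proof (cases "i = m")
      case False
      then show ?thesis using Suc S_Suc[of m] len[of m] by (simp add: nth_append)
    qed simp
  qed simp
  define v :: "nat \<times> unit \<Rightarrow> 'e" where "v = (\<lambda>x. S (Suc (fst x)) ! fst x)"
  have "v x \<in> univ M" for x
    using FS[of "Suc (fst x)"] len[of "Suc (fst x)"] nth_mem[of "fst x" "S (Suc (fst x))"]
    unfolding FS_def v_def by auto
  then have "v \<in> vals" by (simp add: vals_def)
  moreover have "sat M v \<phi>" if "\<phi> \<in> \<Sigma>" for \<phi>
  proof -
    have "finite (fst ` free_vars \<phi>)" using finite_free_vars by blast
    then obtain n where n: "\<forall>i\<in>fst ` free_vars \<phi>. i < n"
      using finite_nat_set_iff_bounded by blast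
    have "{\<phi>} \<subseteq> \<Sigma> \<and> finite {\<phi>}" using that by simp
    then obtain w where w: "\<forall>i<n. w (i, ()) = S n ! i" "sat M w \<phi>"
      using FS[of n] unfolding FS_def len by blast
    have "sat M v \<phi> \<longleftrightarrow> sat M w \<phi>"
    proof (rule sat_cong)
      fix y assume "y \<in> free_vars \<phi>"
      then have "fst y < n" using n by blast
      then show "v y = w y" using w(1) nth[of "fst y" n] by (cases y) (simp add: v_def)
    qed
    then show ?thesis using w(2) by simp
  qed
  ultimately show ?thesis by blast
qed

section \<open>Trees coded by valuations of home variables\<close>

text \<open>The entries of a node \<open>\<zeta>\<close> are held by the variables
  \<open>node \<zeta> y\<close>, those of a possible solution by the variables \<open>aux x\<close>.
  As the two kinds are kept apart, quantifying over the solution leaves the parameters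
  untouched.\<close>

lemma definable_common_solution:
  fixes \<delta> :: "('v, unit, 'f, 'r) fm" and node :: "'n \<Rightarrow> 'v \<times> unit \<Rightarrow> nat \<times> unit"
    and aux :: "'v \<times> unit \<Rightarrow> nat \<times> unit"
  assumes \<delta>: "\<delta> \<in> Form L (X \<union> Y)" and "finite X" and "X \<inter> Y = {}"
    and "inj aux" and aux: "\<And>x \<zeta> y. aux x \<noteq> node \<zeta> y" and "finite N"
  shows "definable UNIV (\<lambda>v. \<exists>b\<in>tuples M X. \<forall>\<zeta>\<in>N.
    holds M b (inst (\<lambda>y. if y \<in> Y then Some (v (node \<zeta> y)) else None) \<delta>))"
proof -
  define \<tau> where "\<tau> \<zeta> x = (Var (if x \<in> X then aux x else node \<zeta> x) :: (nat, unit, 'f) tm)" for \<zeta> x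
  have "definable UNIV (\<lambda>v. sat M (\<lambda>x. tm_val M v (\<tau> \<zeta> x)) \<delta>)" for \<zeta>
    by (rule definable_cong, rule definable_subst[of \<delta> "\<tau> \<zeta>"])
      (use \<delta> Sorts_UNIV in \<open>auto simp: Form_def \<tau>_def\<close>)
  then have "definable (UNIV \<union> aux ` X) (\<lambda>v. \<forall>\<zeta>\<in>N. sat M (\<lambda>x. tm_val M v (\<tau> \<zeta> x)) \<delta>)"
    using \<open>finite N\<close> by (simp add: definable_ball)
  then have "definable UNIV (\<lambda>v. \<exists>w\<in>vals. (\<forall>x. x \<notin> aux ` X \<longrightarrow> w x = v x)
      \<and> (\<forall>\<zeta>\<in>N. sat M (\<lambda>x. tm_val M w (\<tau> \<zeta> x)) \<delta>))"
    by (rule definable_ex) (simp add: \<open>finite X\<close>)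
  then show ?thesis
  proof (rule definable_cong)
    fix v assume v: "v \<in> vals"
    let ?a = "\<lambda>\<zeta> y. if y \<in> Y then Some (v (node \<zeta> y)) else None"
    have eq: "sat M (\<lambda>x. tm_val M w (\<tau> \<zeta> x)) \<delta> \<longleftrightarrow> holds M b (inst (?a \<zeta>) \<delta>)"
      if "\<forall>x. x \<notin> aux ` X \<longrightarrow> w x = v x" "\<forall>x\<in>X. w (aux x) = the (b x)" for w b \<zeta>
      unfolding holds_inst
    proof (rule sat_cong)
      fix x assume "x \<in> free_vars \<delta>"
      then have "x \<in> X \<union> Y" using \<delta> by (auto simp: Form_def)
      moreover have "node \<zeta> x \<notin> aux ` X" using aux by (metis imageE)
      then have "w (node \<zeta> x) = v (node \<zeta> x)" using that(1) by blast
      ultimately show "tm_val M w (\<tau> \<zeta> x) = the ((b ++ ?a \<zeta>) x)"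
        using that(2) \<open>X \<inter> Y = {}\<close> by (auto simp: \<tau>_def map_add_def)
    qed
    show "(\<exists>w\<in>vals. (\<forall>x. x \<notin> aux ` X \<longrightarrow> w x = v x)
        \<and> (\<forall>\<zeta>\<in>N. sat M (\<lambda>x. tm_val M w (\<tau> \<zeta> x)) \<delta>))
      \<longleftrightarrow> (\<exists>b\<in>tuples M X. \<forall>\<zeta>\<in>N. holds M b (inst (?a \<zeta>) \<delta>))" (is "?l \<longleftrightarrow> ?r")
    proof
      assume ?l
      then obtain w where w: "w \<in> vals" "\<forall>x. x \<notin> aux ` X \<longrightarrow> w x = v x"
        "\<forall>\<zeta>\<in>N. sat M (\<lambda>x. tm_val M w (\<tau> \<zeta> x)) \<delta>" by blast
      let ?b = "\<lambda>x. if x \<in> X then Some (w (aux x)) else None"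
      have "?b \<in> tuples M X" using vals_app[OF w(1)] by (auto simp: tuples_def split: if_splits)
      moreover have "\<forall>x\<in>X. w (aux x) = the (?b x)" by simp
      ultimately show ?r using eq[OF w(2), of ?b] w(3) by blast
    next
      assume ?r
      then obtain b where b: "b \<in> tuples M X" "\<forall>\<zeta>\<in>N. holds M b (inst (?a \<zeta>) \<delta>)" by blast
      \<comment> \<open>Injectivity of \<open>aux\<close> gives every entry of \<open>b\<close> a
        place of its own.\<close>
      define w where "w z = (if z \<in> aux ` X then the (b (inv aux z)) else v z)" for z
      have bX: "the (b x) \<in> univ M" if "x \<in> X" for x
        using tuples_the[OF b(1) that] by blast
      have "w z \<in> univ M" for z
        using bX vals_app[OF v] \<open>inj aux\<close> by (auto simp: w_def)
      then have "w \<in> vals" by (simp add: vals_def)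
      moreover have "\<forall>x. x \<notin> aux ` X \<longrightarrow> w x = v x" by (simp add: w_def)
      moreover have "\<forall>x\<in>X. w (aux x) = the (b x)" using \<open>inj aux\<close> by (simp add: w_def)
      ultimately show ?l using eq[of w b] b(2) by blast
    qed
  qed simp
qed

text \<open>The tree property becomes a set of formulas in the variables that hold the nodes: a
  negative one for each choice of \<open>k\<close> siblings and a positive one for each finite path.
  A finite part of it speaks of bounded depth only and is satisfied by a tree of that depth.\<close>

theorem deep_trees_imp_tree_property:
  fixes \<delta> :: "(nat, unit, 'f, 'r) fm"
  assumes sat: "saturated L M" and inf: "infinite (univ M)"
    and XY: "finite X" "finite Y" "X \<inter> Y = {}" and \<delta>: "\<delta> \<in> Form L (X \<union> Y)"
    and deep: "\<And>n. deep_tree (\<lambda>b a. holds M b (inst a \<delta>)) (tuples M X) (tuples M Y) k n (\<lambda>_. True)"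
  shows "tree_property M X Y \<delta> k"
proof -
  \<comment> \<open>Even indices hold the entries of nodes and odd ones the entries of
    solutions.\<close>
  define node :: "nat list \<Rightarrow> nat \<times> unit \<Rightarrow> nat \<times> unit" where
    "node \<zeta> y = (2 * to_nat (\<zeta>, fst y), ())" for \<zeta> y
  define aux :: "nat \<times> unit \<Rightarrow> nat \<times> unit" where "aux x = (2 * fst x + 1, ())" for x
  have aux: "inj aux" "aux x \<noteq> node \<zeta> y" for x \<zeta> y
  proof -
    show "inj aux" by (rule injI) (auto simp: aux_def prod_eq_iff)
    show "aux x \<noteq> node \<zeta> y" unfolding aux_def node_def by (metis Pair_inject Suc_eq_plus1 double_not_eq_Suc_double)
  qed
  let ?R = "\<lambda>b a. holds M b (inst a \<delta>)"
  define asg where "asg v \<zeta> = (\<lambda>y. if y \<in> Y then Some (v (node \<zeta> y)) else None)"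
    for v :: "nat \<times> unit \<Rightarrow> 'e" and \<zeta>
  have asg: "asg v \<zeta> \<in> tuples M Y" if "v \<in> vals" for v \<zeta>
    using vals_app[OF that] by (auto simp: asg_def tuples_def split: if_splits)
  define \<Theta> where "\<Theta> N v \<longleftrightarrow> (\<exists>b\<in>tuples M X. \<forall>\<zeta>\<in>N. ?R b (asg v \<zeta>))" for N v
  have "definable UNIV (\<Theta> N)" if "finite N" for N
    using definable_common_solution[OF \<delta> XY(1,3) aux that] unfolding \<Theta>_def asg_def .
  then have "\<forall>N. \<exists>\<theta>. finite N \<longrightarrow> wf_fm L \<theta> \<and> (\<forall>v\<in>vals. sat M v \<theta> \<longleftrightarrow> \<Theta> N v)"
    unfolding definable_def Form_def by blast
  then obtain \<theta> where \<theta>: "\<And>N. finite N \<Longrightarrow> wf_fm L (\<theta> N)"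
    "\<And>N v. finite N \<Longrightarrow> v \<in> vals \<Longrightarrow> sat M v (\<theta> N) \<longleftrightarrow> \<Theta> N v" by metis
  define children where "children \<eta> I = (\<lambda>i. \<eta> @ [i]) ` I" for \<eta> :: "nat list" and I
  \<comment> \<open>The count starts at 1 because the root carries no instance.\<close>
  define path where "path \<eta> = (\<lambda>j. take j \<eta>) ` {1..length \<eta>}" for \<eta> :: "nat list"
  \<comment> \<open>The strict bound keeps the children of \<open>\<eta>\<close>, which are one
    longer, inside a tree of depth \<open>n\<close>.\<close>
  define \<Sigma> where "\<Sigma> n = {Neg (\<theta> (children \<eta> I)) | \<eta> I. length \<eta> < n \<and> finite I \<and> card I = k}
      \<union> {\<theta> (path \<eta>) | \<eta>. length \<eta> < n}" for n
  have \<Sigma>_mono: "\<Sigma> m \<subseteq> \<Sigma> n" if "m \<le> n" for m n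
    using that unfolding \<Sigma>_def by (auto intro: less_le_trans)
  have "\<exists>v\<in>vals. \<forall>\<phi>\<in>(\<Union>n. \<Sigma> n). sat M v \<phi>"
  proof (rule countable_compactness[OF sat inf])
    show "(\<Union>n. \<Sigma> n) \<subseteq> {\<phi>. wf_fm L \<phi>}"
      using \<theta>(1) by (auto simp: \<Sigma>_def children_def path_def)
    fix q assume "q \<subseteq> (\<Union>n. \<Sigma> n)" "finite q"
    from \<open>finite q\<close> \<open>q \<subseteq> (\<Union>n. \<Sigma> n)\<close> have "\<exists>n. q \<subseteq> \<Sigma> n"
    proof (induction rule: finite_induct)
      case (insert \<phi> q)
      then obtain n m where "q \<subseteq> \<Sigma> n" "\<phi> \<in> \<Sigma> m" by auto
      then have "insert \<phi> q \<subseteq> \<Sigma> (max n m)" using \<Sigma>_mono[of n "max n m"] \<Sigma>_mono[of m "max n m"] by auto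
      then show ?case by blast
    qed simp
    then obtain n where n: "q \<subseteq> \<Sigma> n" by blast
    obtain d where d: "d \<in> univ M" using univ_nonempty by blast
    have "(\<lambda>y. if y \<in> Y then Some d else None) \<in> tuples M Y"
      using d by (auto simp: tuples_def split: if_splits)
    then have "tuples M Y \<noteq> {}" by blast
    from deep_tree_labelling[OF deep[of n] this] obtain t where t:
      "\<And>\<eta>. t \<eta> \<in> tuples M Y"
      "\<And>\<eta>. length \<eta> < n \<Longrightarrow> scattered ?R (tuples M X) k (\<lambda>i. t (\<eta> @ [i]))"
      "\<And>\<eta>. length \<eta> \<le> n \<Longrightarrow> \<exists>b\<in>tuples M X. \<forall>j\<in>{1..length \<eta>}. ?R b (t (take j \<eta>))"
      by blast
    \<comment> \<open>The tree is read back from the coding of \<open>node\<close>. Values at other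
      indices, where \<open>d\<close> may occur, have no influence on
      \<open>\<Theta>\<close>.\<close>
    define v :: "nat \<times> unit \<Rightarrow> 'e" where
      "v = (\<lambda>z. case from_nat (fst z div 2) of (\<zeta>, j) \<Rightarrow>
        (case t \<zeta> (j, ()) of Some e \<Rightarrow> e | None \<Rightarrow> d))"
    have tu: "e \<in> univ M" if "t \<zeta> y = Some e" for \<zeta> y e
      using tuples_Some[OF t(1)[of \<zeta>] that] by blast
    have "v z \<in> univ M" for z
      using d tu by (auto simp: v_def split: prod.split option.split)
    then have v: "v \<in> vals" by (simp add: vals_def)
    have "asg v \<zeta> = t \<zeta>" for \<zeta>
    proof
      fix y
      have "dom (t \<zeta>) = Y" using t(1) by (rule dom_tuples)
      then show "asg v \<zeta> y = t \<zeta> y"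
        by (cases y) (auto simp: asg_def v_def node_def dom_def split: option.split)
    qed
    then have \<Theta>_t: "\<Theta> N v \<longleftrightarrow> (\<exists>b\<in>tuples M X. \<forall>\<zeta>\<in>N. ?R b (t \<zeta>))" for N
      by (simp add: \<Theta>_def)
    have "sat M v \<phi>" if "\<phi> \<in> \<Sigma> n" for \<phi>
      using that unfolding \<Sigma>_def
    proof
      assume "\<phi> \<in> {Neg (\<theta> (children \<eta> I)) | \<eta> I. length \<eta> < n \<and> finite I \<and> card I = k}"
      then obtain \<eta> I where \<phi>: "\<phi> = Neg (\<theta> (children \<eta> I))" "length \<eta> < n" "finite I" "card I = k"
        by blast
      have "\<not> \<Theta> (children \<eta> I) v"
        using t(2)[OF \<phi>(2)] \<phi>(3,4) unfolding \<Theta>_t scattered_def children_def by blast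
      then show ?thesis using \<theta>(2)[OF _ v, of "children \<eta> I"] \<phi>(1,3) by (simp add: children_def)
    next
      assume "\<phi> \<in> {\<theta> (path \<eta>) | \<eta>. length \<eta> < n}"
      then obtain \<eta> where \<phi>: "\<phi> = \<theta> (path \<eta>)" "length \<eta> < n" by blast
      have "\<Theta> (path \<eta>) v" using t(3)[of \<eta>] \<phi>(2) unfolding \<Theta>_t path_def by auto
      then show ?thesis using \<theta>(2)[OF _ v, of "path \<eta>"] \<phi>(1) by (simp add: path_def)
    qed
    then show "\<exists>v\<in>vals. \<forall>\<phi>\<in>q. sat M v \<phi>" using n v by blast
  qed
  then obtain v where v: "v \<in> vals" "\<And>n \<phi>. \<phi> \<in> \<Sigma> n \<Longrightarrow> sat M v \<phi>" by blast
  have "k_inconsistent_seq M X \<delta> k (\<lambda>i. asg v (\<eta> @ [i]))" for \<eta>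
    unfolding k_inconsistent_seq_iff_scattered scattered_def
  proof (intro allI impI)
    fix I :: "nat set" assume I: "finite I \<and> card I = k"
    then have "Neg (\<theta> (children \<eta> I)) \<in> \<Sigma> (Suc (length \<eta>))" unfolding \<Sigma>_def by blast
    then have "\<not> sat M v (\<theta> (children \<eta> I))" using v(2) by fastforce
    then have "\<not> \<Theta> (children \<eta> I) v" using \<theta>(2)[OF _ v(1)] I by (simp add: children_def)
    then show "\<not> (\<exists>b\<in>tuples M X. \<forall>i\<in>I. ?R b (asg v (\<eta> @ [i])))"
      unfolding \<Theta>_def children_def by blast
  qed
  moreover have "consistent M X {inst (asg v (map \<sigma> [0..<n])) \<delta> | n. 0 < n}" for \<sigma>
    unfolding consistent_def
  proof (intro allI impI)
    fix q assume q: "q \<subseteq> {inst (asg v (map \<sigma> [0..<n])) \<delta> | n. 0 < n} \<and> finite q"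
    have "{inst (asg v (map \<sigma> [0..<n])) \<delta> | n. 0 < n}
        = (\<lambda>n. inst (asg v (map \<sigma> [0..<n])) \<delta>) ` {0<..}" by auto
    then have "q \<subseteq> (\<lambda>n. inst (asg v (map \<sigma> [0..<n])) \<delta>) ` {0<..}" "finite q"
      using q by simp_all
    from finite_subset_image[OF this(2,1)] obtain I where I: "I \<subseteq> {0<..}" "finite I"
      "q = (\<lambda>n. inst (asg v (map \<sigma> [0..<n])) \<delta>) ` I" by blast
    \<comment> \<open>Finitely many initial segments of a branch lie on one finite path, of length
      \<open>m\<close>.\<close>
    obtain m where m: "\<forall>n\<in>I. n < m" using I(2) finite_nat_set_iff_bounded by blast
    let ?\<eta> = "map \<sigma> [0..<m]"
    have "\<theta> (path ?\<eta>) \<in> \<Sigma> (Suc (length ?\<eta>))" unfolding \<Sigma>_def by blast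
    then have "\<Theta> (path ?\<eta>) v" using v(2) \<theta>(2)[OF _ v(1), of "path ?\<eta>"] by (auto simp: path_def)
    then obtain b where b: "b \<in> tuples M X" "\<forall>\<zeta>\<in>path ?\<eta>. ?R b (asg v \<zeta>)"
      unfolding \<Theta>_def by blast
    have "map \<sigma> [0..<n] \<in> path ?\<eta>" if "n \<in> I" for n
    proof -
      have "n < m" "0 < n" using that m I(1) by auto
      then have "take n ?\<eta> = map \<sigma> [0..<n]" by (simp add: take_map)
      moreover have "n \<in> {1..length ?\<eta>}" using \<open>n < m\<close> \<open>0 < n\<close> by simp
      ultimately show ?thesis unfolding path_def by (metis imageI)
    qed
    then show "\<exists>b\<in>tuples M X. \<forall>\<phi>\<in>q. holds M b \<phi>" using b I(3) by blast
  qed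
  ultimately show ?thesis
    using asg[OF v(1)] unfolding tree_property_def by (intro exI[of _ "asg v"]) blast
qed

section \<open>Imaginaries\<close>

text \<open>Elements of all sorts are represented uniformly by tuples of home elements; a home
  element is its own representative, as a tuple of length one.\<close>

fun width :: "('f, 'r) eq_sort \<Rightarrow> nat" where
  "width Home = 1"
| "width (Imag n E) = n"

fun elem_of :: "('f, 'r) eq_sort \<Rightarrow> 'e list \<Rightarrow> ('f, 'r, 'e) eq_elem" where
  "elem_of Home as = Real (hd as)"
| "elem_of (Imag n E) as = Class n E (eq_rel M n E `` {as})"

abbreviation "Leq \<equiv> eq_lang L M"
abbreviation "Meq \<equiv> eq_struct L M"

lemma eq_univ_iff:
  "e \<in> univ Meq \<and> srt Meq e = s \<longleftrightarrow> s \<in> Sorts Leq \<and> (\<exists>as\<in>ntuples M (width s). e = elem_of s as)"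
proof (cases s)
  case Home
  have "(\<exists>as\<in>ntuples M 1. e = Real (hd as)) \<longleftrightarrow> e \<in> Real ` univ M"
  proof
    assume "\<exists>as\<in>ntuples M 1. e = Real (hd as)"
    then show "e \<in> Real ` univ M" by (auto simp: ntuples_def length_Suc_conv)
  next
    assume "e \<in> Real ` univ M"
    then obtain a where "a \<in> univ M" "e = Real a" by blast
    then show "\<exists>as\<in>ntuples M 1. e = Real (hd as)"
      by (intro bexI[of _ "[a]"]) (auto simp: ntuples_def)
  qed
  then show ?thesis using Home
    by (auto simp: eq_struct_def eq_lang_def split: eq_elem.splits)
next
  case (Imag n E)
  then show ?thesis by (auto simp: eq_struct_def eq_lang_def)
qed

lemma eq_struct_sel:
  "fint Meq (Old g) as = Real (fint M g (map the_real as))"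
  "fint Meq (Proj n E) as = Class n E (eq_rel M n E `` {map the_real as})"
  "rint Meq r as = rint M r (map the_real as)"
  by (simp_all add: eq_struct_def)

text \<open>A variable \<open>x\<close> of the expansion is represented by the block \<open>\<rho> x\<close> of home variables.\<close>

definition decode ::
  "('v \<times> ('f, 'r) eq_sort \<Rightarrow> (nat \<times> unit) list) \<Rightarrow> (nat \<times> unit \<Rightarrow> 'e)
     \<Rightarrow> 'v \<times> ('f, 'r) eq_sort \<Rightarrow> ('f, 'r, 'e) eq_elem" where
  "decode \<rho> v x = elem_of (snd x) (map v (\<rho> x))"

lemma home_tms_sort:
  "map (tm_sort Leq) ts = ss \<Longrightarrow> set ss \<subseteq> {Home} \<Longrightarrow> t \<in> set ts \<Longrightarrow> tm_sort Leq t = Home"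
  by (auto simp: image_subset_iff)

text \<open>Every function symbol of the expansion takes home arguments only. An imaginary term is
  therefore a variable or a projection applied to home terms, and these terms form a representing
  tuple.\<close>

lemma eq_tm_translation:
  "wf_tm Leq t \<Longrightarrow> (\<And>x. x \<in> tm_vars t \<Longrightarrow> length (\<rho> x) = width (snd x)) \<Longrightarrow>
    \<exists>us. length us = width (tm_sort Leq t)
      \<and> (\<forall>u\<in>set us. wf_tm L u \<and> tm_vars u \<subseteq> (\<Union>x\<in>tm_vars t. set (\<rho> x)))
      \<and> (\<forall>v. tm_val Meq (decode \<rho> v) t = elem_of (tm_sort Leq t) (map (tm_val M v) us))"
proof (induction t)
  case (Var x)
  have "wf_tm L (Var y)" for y :: "nat \<times> unit" by (simp add: Sorts_UNIV)
  moreover have "map (tm_val M v) (map Var (\<rho> x)) = map v (\<rho> x)" for v by simp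
  ultimately show ?case
    using Var by (intro exI[of _ "map Var (\<rho> x)"]) (auto simp: decode_def comp_def)
next
  case (Fn f ts)
  have dom: "set (fdom Leq f) \<subseteq> {Home}"
    by (cases f) (auto simp: eq_lang_def)
  have home: "tm_sort Leq t = Home" if "t \<in> set ts" for t
    by (rule home_tms_sort[OF _ dom that]) (use Fn.prems(1) in simp)
  have "\<exists>u. wf_tm L u \<and> tm_vars u \<subseteq> (\<Union>x\<in>tm_vars t. set (\<rho> x))
      \<and> (\<forall>v. tm_val Meq (decode \<rho> v) t = Real (tm_val M v u))" if t: "t \<in> set ts" for t
  proof -
    have "wf_tm Leq t" using Fn.prems(1) t by simp
    moreover have "length (\<rho> x) = width (snd x)" if "x \<in> tm_vars t" for x
      using Fn.prems(2)[of x] that t by auto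
    ultimately obtain us where us: "length us = width (tm_sort Leq t)"
      "\<forall>u\<in>set us. wf_tm L u \<and> tm_vars u \<subseteq> (\<Union>x\<in>tm_vars t. set (\<rho> x))"
      "\<forall>v. tm_val Meq (decode \<rho> v) t = elem_of (tm_sort Leq t) (map (tm_val M v) us)"
      using Fn.IH[OF t] by blast
    then obtain u where "us = [u]" using home[OF t] by (auto simp: length_Suc_conv)
    then show ?thesis using us home[OF t] by auto
  qed
  then obtain h where h: "\<And>t. t \<in> set ts \<Longrightarrow> wf_tm L (h t)"
    "\<And>t. t \<in> set ts \<Longrightarrow> tm_vars (h t) \<subseteq> (\<Union>x\<in>tm_vars t. set (\<rho> x))"
    "\<And>t v. t \<in> set ts \<Longrightarrow> tm_val Meq (decode \<rho> v) t = Real (tm_val M v (h t))"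
    by metis
  have args: "map the_real (map (tm_val Meq (decode \<rho> v)) ts) = map (tm_val M v) (map h ts)" for v
    using h(3) by auto
  have len: "length ts = length (fdom Leq f)" using Fn.prems(1) by (metis length_map wf_tm.simps(2))
  show ?case
  proof (cases f)
    case (Old g)
    have "map (tm_sort L) (map h ts) = fdom L g"
      using len Old by (subst unit_list_eq_iff) (simp add: eq_lang_def)
    moreover have "g \<in> Funs L" using Fn.prems(1) Old by (auto simp: eq_lang_def)
    ultimately have "wf_tm L (Fn g (map h ts))" using h(1) by auto
    moreover have "tm_vars (Fn g (map h ts)) \<subseteq> (\<Union>x\<in>tm_vars (Fn f ts). set (\<rho> x))"
      using h(2) by fastforce
    moreover have "tm_val Meq (decode \<rho> v) (Fn f ts) = Real (tm_val M v (Fn g (map h ts)))" for v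
      by (simp only: Old tm_val.simps eq_struct_sel args)
    moreover have "tm_sort Leq (Fn f ts) = Home" using Old by (simp add: eq_lang_def)
    ultimately show ?thesis by (intro exI[of _ "[Fn g (map h ts)]"]) simp
  next
    case (Proj n E)
    have "tm_sort Leq (Fn f ts) = Imag n E" using Proj by (simp add: eq_lang_def)
    moreover have "length (map h ts) = n" using len Proj by (simp add: eq_lang_def)
    moreover have "tm_vars (h t) \<subseteq> (\<Union>x\<in>tm_vars (Fn f ts). set (\<rho> x))" if "t \<in> set ts" for t
      using h(2)[OF that] that by fastforce
    moreover have "tm_val Meq (decode \<rho> v) (Fn f ts)
        = Class n E (eq_rel M n E `` {map (tm_val M v) (map h ts)})" for v
      by (simp only: Proj tm_val.simps eq_struct_sel args)
    ultimately show ?thesis using h(1) by (intro exI[of _ "map h ts"]) auto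
  qed
qed

lemma map_in_ntuples: "v \<in> vals \<Longrightarrow> map v xs \<in> ntuples M (length xs)"
  using vals_app by (auto simp: ntuples_def)

lemma vals_with_block:
  assumes "v \<in> vals" "distinct xs" "as \<in> ntuples M (length xs)"
  shows "\<exists>w\<in>vals. (\<forall>y. y \<notin> set xs \<longrightarrow> w y = v y) \<and> map w xs = as"
proof -
  define w where "w y = (case map_of (zip xs as) y of None \<Rightarrow> v y | Some e \<Rightarrow> e)" for y
  have len: "length as = length xs" and sub: "set as \<subseteq> univ M" using assms(3) by (auto simp: ntuples_def)
  have "w y \<in> univ M" for y
    using vals_app[OF assms(1)] sub
    by (auto simp: w_def split: option.split dest!: map_of_SomeD dest: set_zip_rightD)
  then have "w \<in> vals" by (simp add: vals_def)
  moreover have "w y = v y" if "y \<notin> set xs" for y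
  proof -
    have "map_of (zip xs as) y = None" using that map_of_zip_is_None[OF len[symmetric]] by blast
    then show ?thesis by (simp only: w_def option.case)
  qed
  moreover have "map w xs = as"
    by (rule nth_equalityI) (use len assms(2) in \<open>auto simp: w_def map_of_zip_nth\<close>)
  ultimately show ?thesis by blast
qed

text \<open>Only two constructs change: equality of imaginaries becomes the defining equivalence of
  representatives, and a quantifier becomes a block of home quantifiers. Relations of the expansion
  concern home elements only.\<close>

lemma eq_fm_translation:
  "wf_fm Leq \<phi> \<Longrightarrow> (\<And>x. x \<in> free_vars \<phi> \<Longrightarrow> length (\<rho> x) = width (snd x)) \<Longrightarrow>
    definable (\<Union>x\<in>free_vars \<phi>. set (\<rho> x)) (\<lambda>v. sat Meq (decode \<rho> v) \<phi>)"
proof (induction \<phi> arbitrary: \<rho>)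
  case (Eq t u)
  let ?W = "\<Union>x\<in>tm_vars t \<union> tm_vars u. set (\<rho> x)"
  have "wf_tm Leq t" "\<And>x. x \<in> tm_vars t \<Longrightarrow> length (\<rho> x) = width (snd x)"
    using Eq.prems by simp_all
  then obtain ts where ts: "length ts = width (tm_sort Leq t)"
    "\<forall>t'\<in>set ts. wf_tm L t' \<and> tm_vars t' \<subseteq> (\<Union>x\<in>tm_vars t. set (\<rho> x))"
    "\<forall>v. tm_val Meq (decode \<rho> v) t = elem_of (tm_sort Leq t) (map (tm_val M v) ts)"
    using eq_tm_translation[of t \<rho>] by blast
  have "wf_tm Leq u" "\<And>x. x \<in> tm_vars u \<Longrightarrow> length (\<rho> x) = width (snd x)"
    using Eq.prems by simp_all
  then obtain us where us: "length us = width (tm_sort Leq u)"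
    "\<forall>u'\<in>set us. wf_tm L u' \<and> tm_vars u' \<subseteq> (\<Union>x\<in>tm_vars u. set (\<rho> x))"
    "\<forall>v. tm_val Meq (decode \<rho> v) u = elem_of (tm_sort Leq u) (map (tm_val M v) us)"
    using eq_tm_translation[of u \<rho>] by blast
  have sorts: "tm_sort Leq u = tm_sort Leq t" using Eq.prems(1) by simp
  have W: "wf_tm L t' \<and> tm_vars t' \<subseteq> ?W" if "t' \<in> set (ts @ us)" for t'
    using that ts(2) us(2) by fastforce
  show ?case
  proof (cases "tm_sort Leq t")
    case Home
    then obtain t' u' where tu: "ts = [t']" "us = [u']"
      using ts(1) us(1) sorts by (auto simp: length_Suc_conv)
    then show ?thesis
      by (intro definableI[of "Eq t' u'"]) (use W ts(3) us(3) Home sorts in auto)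
  next
    case (Imag n E)
    \<comment> \<open>Membership in the language is what makes \<open>E\<close> an equivalence
      relation, so that equality of classes is expressed by \<open>E\<close>.\<close>
    have "tm_sort Leq t \<in> Sorts Leq"
    proof (cases t)
      case (Fn f rs)
      then show ?thesis using Eq.prems(1) Imag by (cases f) (auto simp: eq_lang_def)
    next
      case (Var x)
      then show ?thesis using Eq.prems(1) by (metis tm_sort.simps(1) wf_fm.simps(1) wf_tm.simps(1))
    qed
    then have "def_equiv L M n E" using Imag by (auto simp: eq_lang_def)
    then have E: "wf_fm L E" "free_vars E \<subseteq> {..<2 * n} \<times> UNIV" "equiv (ntuples M n) (eq_rel M n E)"
      by (auto simp: def_equiv_def Form_def)
    have len: "length ts = n" "length us = n" using ts(1) us(1) sorts Imag by auto
    \<comment> \<open>This follows the convention that the first \<open>n\<close> variables of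
      \<open>E\<close> are the left argument and the next \<open>n\<close> the right one.\<close>
    define \<tau> where "\<tau> x = (ts @ us) ! fst x" for x :: "nat \<times> unit"
    have \<tau>: "\<tau> x \<in> set (ts @ us)" if "x \<in> free_vars E" for x
      unfolding \<tau>_def by (rule nth_mem) (use that E(2) len in auto)
    have "definable ?W (\<lambda>v. sat M (\<lambda>x. tm_val M v (\<tau> x)) E)"
      by (rule definable_cong, rule definable_subst[of E \<tau>]) (use E(1) W \<tau> in blast)+
    then show ?thesis
    proof (rule definable_cong)
      fix v assume v: "v \<in> vals"
      let ?as = "map (tm_val M v) ts" and ?bs = "map (tm_val M v) us"
      have n: "?as \<in> ntuples M n" "?bs \<in> ntuples M n"
        using W tm_val_in_univ[OF _ v] len by (auto simp: ntuples_def)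
      have "sat Meq (decode \<rho> v) (Eq t u) \<longleftrightarrow> eq_rel M n E `` {?as} = eq_rel M n E `` {?bs}"
        using ts(3) us(3) sorts Imag by simp
      also have "\<dots> \<longleftrightarrow> (?as, ?bs) \<in> eq_rel M n E"
        by (rule eq_equiv_class_iff[OF E(3) n])
      also have "\<dots> \<longleftrightarrow> sat M (\<lambda>x. (?as @ ?bs) ! fst x) E"
        using n by (simp add: eq_rel_def)
      also have "\<dots> \<longleftrightarrow> sat M (\<lambda>x. tm_val M v (\<tau> x)) E"
      proof (rule sat_cong)
        fix x assume "x \<in> free_vars E"
        then have "fst x < length (ts @ us)" using E(2) len by auto
        then have "map (tm_val M v) (ts @ us) ! fst x = tm_val M v ((ts @ us) ! fst x)"
          by (rule nth_map)
        then show "(?as @ ?bs) ! fst x = tm_val M v (\<tau> x)" by (simp add: \<tau>_def)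
      qed
      finally show "sat M (\<lambda>x. tm_val M v (\<tau> x)) E \<longleftrightarrow> sat Meq (decode \<rho> v) (Eq t u)" by simp
    qed simp
  qed
next
  case (Rel r ts)
  have home: "tm_sort Leq t = Home" if "t \<in> set ts" for t
    by (rule home_tms_sort[OF _ _ that, of "rdom Leq r"])
      (use Rel.prems(1) in simp, auto simp: eq_lang_def)
  have "\<exists>u. wf_tm L u \<and> tm_vars u \<subseteq> (\<Union>x\<in>tm_vars t. set (\<rho> x))
      \<and> (\<forall>v. tm_val Meq (decode \<rho> v) t = Real (tm_val M v u))" if t: "t \<in> set ts" for t
  proof -
    have "wf_tm Leq t" using Rel.prems(1) t by simp
    moreover have "length (\<rho> x) = width (snd x)" if "x \<in> tm_vars t" for x
      using Rel.prems(2)[of x] that t by auto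
    ultimately obtain us where us: "length us = width (tm_sort Leq t)"
      "\<forall>u\<in>set us. wf_tm L u \<and> tm_vars u \<subseteq> (\<Union>x\<in>tm_vars t. set (\<rho> x))"
      "\<forall>v. tm_val Meq (decode \<rho> v) t = elem_of (tm_sort Leq t) (map (tm_val M v) us)"
      using eq_tm_translation[of t \<rho>] by blast
    then obtain u where "us = [u]" using home[OF t] by (auto simp: length_Suc_conv)
    then show ?thesis using us home[OF t] by auto
  qed
  then obtain h where h: "\<And>t. t \<in> set ts \<Longrightarrow> wf_tm L (h t)"
    "\<And>t. t \<in> set ts \<Longrightarrow> tm_vars (h t) \<subseteq> (\<Union>x\<in>tm_vars t. set (\<rho> x))"
    "\<And>t v. t \<in> set ts \<Longrightarrow> tm_val Meq (decode \<rho> v) t = Real (tm_val M v (h t))"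
    by metis
  have args: "map the_real (map (tm_val Meq (decode \<rho> v)) ts) = map (tm_val M v) (map h ts)" for v
    using h(3) by auto
  have "length ts = length (rdom Leq r)" using Rel.prems(1) by (metis length_map wf_fm.simps(2))
  then have "map (tm_sort L) (map h ts) = rdom L r"
    by (subst unit_list_eq_iff) (simp add: eq_lang_def)
  moreover have "r \<in> Rels L" using Rel.prems(1) by (simp add: eq_lang_def)
  ultimately have "wf_fm L (Rel r (map h ts))" using h(1) by auto
  moreover have "free_vars (Rel r (map h ts)) \<subseteq> (\<Union>x\<in>free_vars (Rel r ts). set (\<rho> x))"
    using h(2) by fastforce
  moreover have "sat M v (Rel r (map h ts)) \<longleftrightarrow> sat Meq (decode \<rho> v) (Rel r ts)" for v
    by (simp only: sat.simps eq_struct_sel args)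
  ultimately show ?case by (rule definableI)
next
  case (Neg \<phi>)
  have "definable (\<Union>x\<in>free_vars \<phi>. set (\<rho> x)) (\<lambda>v. \<not> sat Meq (decode \<rho> v) \<phi>)"
    by (rule definable_Not, rule Neg.IH) (use Neg.prems in auto)
  then show ?case by simp
next
  case (And \<phi> \<psi>)
  let ?W = "\<Union>x\<in>free_vars (And \<phi> \<psi>). set (\<rho> x)"
  have "definable ?W (\<lambda>v. sat Meq (decode \<rho> v) \<phi>)"
    by (rule definable_cong, rule And.IH(1)) (use And.prems in auto)
  moreover have "definable ?W (\<lambda>v. sat Meq (decode \<rho> v) \<psi>)"
    by (rule definable_cong, rule And.IH(2)) (use And.prems in auto)
  ultimately show ?case by (simp only: sat.simps) (rule definable_conj)
next
  case (Ex x \<phi>)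
  let ?W = "\<Union>y\<in>free_vars (Ex x \<phi>). set (\<rho> y)"
  have "finite ?W" by (simp add: finite_free_vars)
  \<comment> \<open>The block for the quantified variable is chosen away from the blocks of the
    remaining free variables, whose values must not change.\<close>
  then have "infinite (UNIV - ?W)"
    by (rule Diff_infinite_finite) (simp add: finite_prod)
  then obtain V where V: "V \<subseteq> UNIV - ?W" "card V = width (snd x)" "finite V"
    by (rule infinite_arbitrarily_large[THEN exE]) blast
  then obtain xs where xs: "set xs = V" "distinct xs" "length xs = width (snd x)"
    using finite_distinct_list[OF V(3)] distinct_card by metis
  let ?\<rho> = "\<rho>(x := xs)"
  have "definable (\<Union>y\<in>free_vars \<phi>. set (?\<rho> y)) (\<lambda>v. sat Meq (decode ?\<rho> v) \<phi>)"
  proof (rule Ex.IH)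
    show "wf_fm Leq \<phi>" using Ex.prems(1) by simp
    show "length (?\<rho> y) = width (snd y)" if "y \<in> free_vars \<phi>" for y
      using Ex.prems(2)[of y] that xs(3) by (cases "y = x") simp_all
  qed
  moreover have "(\<Union>y\<in>free_vars \<phi>. set (?\<rho> y)) \<subseteq> ?W \<union> V"
    using xs(1) by (auto split: if_splits)
  ultimately have "definable (?W \<union> V) (\<lambda>v. sat Meq (decode ?\<rho> v) \<phi>)"
    using definable_cong[OF _ refl] by blast
  then have "definable ?W (\<lambda>v. \<exists>w\<in>vals. (\<forall>y. y \<notin> V \<longrightarrow> w y = v y) \<and> sat Meq (decode ?\<rho> w) \<phi>)"
    by (rule definable_ex) (rule V(3))
  then show ?case
  proof (rule definable_cong)
    fix v assume v: "v \<in> vals"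
    have eq: "sat Meq (decode ?\<rho> w) \<phi> \<longleftrightarrow> sat Meq ((decode \<rho> v)(x := elem_of (snd x) (map w xs))) \<phi>"
      if w: "\<forall>y. y \<notin> V \<longrightarrow> w y = v y" for w
    proof (rule sat_cong)
      fix y assume y: "y \<in> free_vars \<phi>"
      show "decode ?\<rho> w y = ((decode \<rho> v)(x := elem_of (snd x) (map w xs))) y"
      proof (cases "y = x")
        case True
        then show ?thesis by (simp add: decode_def)
      next
        case False
        then have "set (\<rho> y) \<subseteq> ?W" using y by auto
        then have "map w (\<rho> y) = map v (\<rho> y)" using w V(1) by (intro map_cong) auto
        then show ?thesis using False by (simp add: decode_def del: map_eq_conv)
      qed
    qed
    show "(\<exists>w\<in>vals. (\<forall>y. y \<notin> V \<longrightarrow> w y = v y) \<and> sat Meq (decode ?\<rho> w) \<phi>)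
      \<longleftrightarrow> sat Meq (decode \<rho> v) (Ex x \<phi>)" (is "?l \<longleftrightarrow> ?r")
    proof
      assume ?l
      then obtain w where w: "w \<in> vals" "\<forall>y. y \<notin> V \<longrightarrow> w y = v y" "sat Meq (decode ?\<rho> w) \<phi>"
        by blast
      have "snd x \<in> Sorts Leq" using Ex.prems(1) by simp
      moreover have "map w xs \<in> ntuples M (width (snd x))" using map_in_ntuples[OF w(1)] xs(3) by metis
      ultimately have "elem_of (snd x) (map w xs) \<in> univ Meq"
        "srt Meq (elem_of (snd x) (map w xs)) = snd x" using eq_univ_iff by blast+
      then show ?r using eq[OF w(2)] w(3) by auto
    next
      assume ?r
      then obtain e where e: "e \<in> univ Meq" "srt Meq e = snd x" "sat Meq ((decode \<rho> v)(x := e)) \<phi>"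
        by auto
      then obtain as where as: "as \<in> ntuples M (width (snd x))" "e = elem_of (snd x) as"
        using eq_univ_iff by blast
      have "as \<in> ntuples M (length xs)" using as(1) xs(3) by simp
      then obtain w where w: "w \<in> vals" "\<forall>y. y \<notin> V \<longrightarrow> w y = v y" "map w xs = as"
        using vals_with_block[OF v xs(2)] xs(1) by blast
      then show ?l using eq[OF w(2)] e(3) as(2) by blast
    qed
  qed (rule order_refl)
qed

text \<open>Outside the domain some member of the universe is taken, so that tuples give valuations
  in \<open>vals\<close>.\<close>

definition val_of :: "(nat \<times> unit \<rightharpoonup> 'e) \<Rightarrow> nat \<times> unit \<Rightarrow> 'e" where
  "val_of b x = (case b x of None \<Rightarrow> SOME d. d \<in> univ M | Some e \<Rightarrow> e)"

lemma val_of_dom: "z \<in> dom b \<Longrightarrow> val_of b z = the (b z)"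
  by (auto simp: val_of_def)

lemma val_of_vals: "b \<in> tuples M X \<Longrightarrow> val_of b \<in> vals"
  unfolding vals_def val_of_def using tuples_Some[of b M X] univ_nonempty
  by (auto split: option.split intro: someI_ex)

definition decode_tuple ::
  "('v \<times> ('f, 'r) eq_sort \<Rightarrow> (nat \<times> unit) list) \<Rightarrow> ('v \<times> ('f, 'r) eq_sort) set
     \<Rightarrow> (nat \<times> unit \<rightharpoonup> 'e) \<Rightarrow> ('v, ('f, 'r) eq_sort, ('f, 'r, 'e) eq_elem) tuple" where
  "decode_tuple \<rho> X b = (\<lambda>x. if x \<in> X then Some (decode \<rho> (val_of b) x) else None)"

text \<open>For surjectivity, representatives of the entries are chosen separately. Since no home
  variable occurs twice in the blocks, these choices never conflict and form one tuple.\<close>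

lemma decode_tuple_image:
  assumes len: "\<And>x. x \<in> X \<Longrightarrow> length (\<rho> x) = width (snd x)"
    and dist: "\<And>x. x \<in> X \<Longrightarrow> distinct (\<rho> x)"
    and disj: "\<And>x y. x \<in> X \<Longrightarrow> y \<in> X \<Longrightarrow> x \<noteq> y \<Longrightarrow> set (\<rho> x) \<inter> set (\<rho> y) = {}"
    and sorts: "snd ` X \<subseteq> Sorts Leq"
  shows "decode_tuple \<rho> X ` tuples M (\<Union>x\<in>X. set (\<rho> x)) = tuples Meq X"
proof
  show "decode_tuple \<rho> X ` tuples M (\<Union>x\<in>X. set (\<rho> x)) \<subseteq> tuples Meq X"
  proof
    fix c assume "c \<in> decode_tuple \<rho> X ` tuples M (\<Union>x\<in>X. set (\<rho> x))"
    then obtain b where b: "b \<in> tuples M (\<Union>x\<in>X. set (\<rho> x))" "c = decode_tuple \<rho> X b" by blast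
    have "decode \<rho> (val_of b) x \<in> univ Meq \<and> srt Meq (decode \<rho> (val_of b) x) = snd x"
      if "x \<in> X" for x
    proof -
      have "map (val_of b) (\<rho> x) \<in> ntuples M (width (snd x))"
        using map_in_ntuples[OF val_of_vals[OF b(1)], of "\<rho> x"] len[OF that] by simp
      then show ?thesis using eq_univ_iff sorts that unfolding decode_def by blast
    qed
    then show "c \<in> tuples Meq X"
      unfolding b(2) tuples_def decode_tuple_def by (auto simp: dom_def split: if_splits)
  qed
  show "tuples Meq X \<subseteq> decode_tuple \<rho> X ` tuples M (\<Union>x\<in>X. set (\<rho> x))"
  proof
    fix c assume c: "c \<in> tuples Meq X"
    have "\<exists>as\<in>ntuples M (width (snd x)). the (c x) = elem_of (snd x) as" if "x \<in> X" for x
      using tuples_the[OF c that] eq_univ_iff by blast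
    then obtain h where h: "\<And>x. x \<in> X \<Longrightarrow> h x \<in> ntuples M (width (snd x))"
      "\<And>x. x \<in> X \<Longrightarrow> the (c x) = elem_of (snd x) (h x)" by metis
    define W where "W = (\<Union>x\<in>X. set (\<rho> x))"
    have "\<exists>e\<in>univ M. \<forall>x\<in>X. \<forall>i<length (\<rho> x). \<rho> x ! i = z \<longrightarrow> h x ! i = e" if z: "z \<in> W" for z
    proof -
      obtain x i where xi: "x \<in> X" "i < length (\<rho> x)" "\<rho> x ! i = z"
        using z by (auto simp: W_def in_set_conv_nth)
      have "i < length (h x)" using h(1)[OF xi(1)] len[OF xi(1)] xi(2) by (simp add: ntuples_def)
      then have "h x ! i \<in> univ M" using h(1)[OF xi(1)] nth_mem[of i "h x"] by (auto simp: ntuples_def)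
      moreover have "h y ! j = h x ! i" if "y \<in> X" "j < length (\<rho> y)" "\<rho> y ! j = z" for y j
      proof -
        have "z \<in> set (\<rho> x) \<inter> set (\<rho> y)" using xi that nth_mem[of i "\<rho> x"] nth_mem[of j "\<rho> y"] by simp
        then have "y = x" using disj xi(1) that(1) by blast
        then have "j = i" using that(2,3) xi(2,3) nth_eq_iff_index_eq[OF dist[OF xi(1)], of j i] by simp
        then show ?thesis using \<open>y = x\<close> by simp
      qed
      ultimately show ?thesis by blast
    qed
    then obtain g where g: "\<And>z. z \<in> W \<Longrightarrow> g z \<in> univ M"
      "\<And>z x i. z \<in> W \<Longrightarrow> x \<in> X \<Longrightarrow> i < length (\<rho> x) \<Longrightarrow> \<rho> x ! i = z \<Longrightarrow> h x ! i = g z"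
      by metis
    define b where "b z = (if z \<in> W then Some (g z) else None)" for z
    have bW: "b \<in> tuples M W" using g(1) by (auto simp: tuples_def b_def split: if_splits)
    have "decode \<rho> (val_of b) x = the (c x)" if x: "x \<in> X" for x
    proof -
      have "map (val_of b) (\<rho> x) = h x"
      proof (rule nth_equalityI)
        show "length (map (val_of b) (\<rho> x)) = length (h x)"
          using h(1)[OF x] len[OF x] by (simp add: ntuples_def)
        fix i assume i: "i < length (map (val_of b) (\<rho> x))"
        then have "\<rho> x ! i \<in> W" using x by (auto simp: W_def intro!: bexI[of _ x])
        then show "map (val_of b) (\<rho> x) ! i = h x ! i"
          using g(2)[OF _ x, of "\<rho> x ! i" i] i by (simp add: val_of_def b_def)
      qed
      then show ?thesis using h(2)[OF x] by (simp add: decode_def)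
    qed
    then have "decode_tuple \<rho> X b x = c x" for x
      using dom_tuples[OF c] by (cases "c x") (auto simp: decode_tuple_def)
    then have "c = decode_tuple \<rho> X b" by auto
    then show "c \<in> decode_tuple \<rho> X ` tuples M (\<Union>x\<in>X. set (\<rho> x))" using bW by (auto simp: W_def)
  qed
qed

lemma ex_block_representation:
  assumes "finite V"
  shows "\<exists>\<rho> :: 'v \<times> ('f, 'r) eq_sort \<Rightarrow> (nat \<times> unit) list.
    (\<forall>x\<in>V. length (\<rho> x) = width (snd x) \<and> distinct (\<rho> x))
    \<and> (\<forall>x\<in>V. \<forall>y\<in>V. x \<noteq> y \<longrightarrow> set (\<rho> x) \<inter> set (\<rho> y) = {})"
proof -
  obtain g :: "'v \<times> ('f, 'r) eq_sort \<Rightarrow> nat" where g: "inj_on g V"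
    using finite_imp_inj_to_nat_seg[OF assms] by blast
  \<comment> \<open>\<open>g x\<close> numbers the variable and \<open>j\<close> the place in its
    block; coding the pair keeps all places distinct.\<close>
  define \<rho> where "\<rho> x = map (\<lambda>j. (to_nat (g x, j), ())) [0..<width (snd x)]" for x
  have "distinct (\<rho> x)" for x by (auto simp: \<rho>_def distinct_map inj_on_def)
  moreover have "set (\<rho> x) \<inter> set (\<rho> y) = {}" if "x \<in> V" "y \<in> V" "x \<noteq> y" for x y
    using that(3) inj_on_eq_iff[OF g that(1,2)] by (auto simp: \<rho>_def)
  ultimately show ?thesis by (intro exI[of _ \<rho>]) (auto simp: \<rho>_def)
qed

section \<open>From trees of imaginaries to rosiness\<close>

theorem eq_deep_trees_transfer:
  fixes X Y :: "('v \<times> ('f, 'r) eq_sort) set"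
  assumes XY: "finite X" "finite Y" "X \<inter> Y = {}" and \<delta>: "\<delta> \<in> Form Leq (X \<union> Y)"
    and deep: "\<And>n. deep_tree (\<lambda>b a. holds Meq b (inst a \<delta>)) (tuples Meq X) (tuples Meq Y) k n P"
  shows "\<exists>(X' :: (nat \<times> unit) set) Y' \<delta>'.
    finite X' \<and> finite Y' \<and> X' \<inter> Y' = {} \<and> \<delta>' \<in> Form L (X' \<union> Y')
    \<and> (\<forall>n. deep_tree (\<lambda>b a. holds M b (inst a \<delta>')) (tuples M X') (tuples M Y') k n (\<lambda>_. True))"
proof -
  obtain \<rho> :: "'v \<times> ('f, 'r) eq_sort \<Rightarrow> (nat \<times> unit) list" where
    \<rho>: "\<And>x. x \<in> X \<union> Y \<Longrightarrow> length (\<rho> x) = width (snd x)"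
    "\<And>x. x \<in> X \<union> Y \<Longrightarrow> distinct (\<rho> x)"
    "\<And>x y. x \<in> X \<union> Y \<Longrightarrow> y \<in> X \<union> Y \<Longrightarrow> x \<noteq> y \<Longrightarrow> set (\<rho> x) \<inter> set (\<rho> y) = {}"
    using ex_block_representation[OF finite_UnI[OF XY(1,2)]] by blast
  \<comment> \<open>A tree of depth one provides tuples for \<open>X\<close> and for
    \<open>Y\<close>, and hence shows that the sorts of these variables belong to the
    language.\<close>
  obtain b0 a0 where ba0: "b0 \<in> tuples Meq X" "a0 \<in> tuples Meq Y"
    using deep[of "Suc 0"] by fastforce
  have sorts: "snd ` V \<subseteq> Sorts Leq" if "c \<in> tuples Meq V"
    for V and c :: "('v, ('f, 'r) eq_sort, ('f, 'r, 'e) eq_elem) tuple"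
    using tuples_the[OF that] eq_univ_iff by blast
  let ?X' = "\<Union>x\<in>X. set (\<rho> x)" and ?Y' = "\<Union>x\<in>Y. set (\<rho> x)"
  have disj: "?X' \<inter> ?Y' = {}" using \<rho>(3) XY(3) by blast
  have imX: "decode_tuple \<rho> X ` tuples M ?X' = tuples Meq X"
    by (rule decode_tuple_image) (use \<rho> sorts[OF ba0(1)] in auto)
  have imY: "decode_tuple \<rho> Y ` tuples M ?Y' = tuples Meq Y"
    by (rule decode_tuple_image) (use \<rho> sorts[OF ba0(2)] in auto)
  have "wf_fm Leq \<delta>" "free_vars \<delta> \<subseteq> X \<union> Y" using \<delta> by (auto simp: Form_def)
  then have "definable (\<Union>x\<in>free_vars \<delta>. set (\<rho> x)) (\<lambda>v. sat Meq (decode \<rho> v) \<delta>)"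
    using \<rho>(1) by (intro eq_fm_translation) auto
  then obtain \<delta>' where \<delta>': "wf_fm L \<delta>'" "free_vars \<delta>' \<subseteq> (\<Union>x\<in>free_vars \<delta>. set (\<rho> x))"
    "\<And>v. v \<in> vals \<Longrightarrow> sat M v \<delta>' \<longleftrightarrow> sat Meq (decode \<rho> v) \<delta>" by (rule definableE) blast
  have \<delta>'_vars: "free_vars \<delta>' \<subseteq> ?X' \<union> ?Y'" using \<delta>'(2) \<open>free_vars \<delta> \<subseteq> X \<union> Y\<close> by blast
  define rep where "rep = inv_into (tuples M ?Y') (decode_tuple \<rho> Y)"
  have rep: "rep a \<in> tuples M ?Y'" "decode_tuple \<rho> Y (rep a) = a" if "a \<in> tuples Meq Y" for a
    using that imY inv_into_into[of a "decode_tuple \<rho> Y" "tuples M ?Y'"]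
      f_inv_into_f[of a "decode_tuple \<rho> Y" "tuples M ?Y'"] by (auto simp: rep_def)
  have R: "holds M b (inst (rep a) \<delta>') \<longleftrightarrow> holds Meq (decode_tuple \<rho> X b) (inst a \<delta>)"
    if b: "b \<in> tuples M ?X'" and a: "a \<in> tuples Meq Y" for b a
  proof -
    let ?c = "b ++ rep a"
    have a': "rep a \<in> tuples M ?Y'" using rep(1)[OF a] .
    have c: "?c \<in> tuples M (?X' \<union> ?Y')"
      using b a' by (rule tuples_map_add)
    have "holds M b (inst (rep a) \<delta>') \<longleftrightarrow> sat M (val_of ?c) \<delta>'"
      unfolding holds_inst
    proof (rule sat_cong)
      fix z assume "z \<in> free_vars \<delta>'"
      then have "z \<in> dom ?c" unfolding dom_tuples[OF c] by (rule subsetD[OF \<delta>'_vars])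
      then show "the (?c z) = val_of ?c z" by (simp only: val_of_dom)
    qed
    also have "\<dots> \<longleftrightarrow> sat Meq (decode \<rho> (val_of ?c)) \<delta>" by (rule \<delta>'(3)[OF val_of_vals[OF c]])
    also have "\<dots> \<longleftrightarrow> holds Meq (decode_tuple \<rho> X b) (inst a \<delta>)"
      unfolding holds_inst
    proof (rule sat_cong)
      fix x assume "x \<in> free_vars \<delta>"
      then consider "x \<in> X" "x \<notin> Y" | "x \<in> Y" using \<delta> by (auto simp: Form_def)
      then show "decode \<rho> (val_of ?c) x = the ((decode_tuple \<rho> X b ++ a) x)"
      proof cases
        case 1
        have "val_of ?c z = val_of b z" if "z \<in> set (\<rho> x)" for z
        proof -
          have "z \<notin> dom (rep a)" unfolding dom_tuples[OF a'] using that 1(1) disj by blast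
          then show ?thesis by (simp add: val_of_def map_add_def domIff)
        qed
        then have "map (val_of ?c) (\<rho> x) = map (val_of b) (\<rho> x)" by simp
        moreover have "a x = None"
          using 1(2) unfolding dom_tuples[OF a, symmetric] by (simp add: domIff)
        ultimately show ?thesis
          using 1(1) by (simp add: decode_def decode_tuple_def map_add_def del: map_eq_conv)
      next
        case 2
        have "val_of ?c z = val_of (rep a) z" if "z \<in> set (\<rho> x)" for z
        proof -
          have "z \<in> dom (rep a)" unfolding dom_tuples[OF a'] using that 2 by blast
          then show ?thesis by (auto simp: val_of_def map_add_def)
        qed
        then have "map (val_of ?c) (\<rho> x) = map (val_of (rep a)) (\<rho> x)" by simp
        moreover have "a x = Some (decode \<rho> (val_of (rep a)) x)"
          using 2 rep(2)[OF a] by (metis decode_tuple_def)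
        ultimately show ?thesis by (simp add: decode_def map_add_def del: map_eq_conv)
      qed
    qed
    finally show ?thesis .
  qed
  have "deep_tree (\<lambda>b a. holds M b (inst a \<delta>')) (tuples M ?X') (tuples M ?Y') k n (\<lambda>_. True)" for n
    \<comment> \<open>The initial condition \<open>P\<close>, coming from a formula with parameters,
      is weakened to \<open>True\<close>: the tree property concerns instances of one formula
      alone.\<close>
    by (rule deep_tree_mono[OF deep_tree_transfer[OF deep[of n], of rep, OF rep(1) imX R]]) auto
  moreover have "\<delta>' \<in> Form L (?X' \<union> ?Y')" using \<delta>'(1) \<delta>'_vars by (simp add: Form_def)
  ultimately show ?thesis using XY(1,2) disj
    by (intro exI[of _ ?X'] exI[of _ ?Y'] exI[of _ \<delta>']) auto
qed

theorem simple_imp_eq_rosy: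
  assumes sat: "saturated L M" and inf: "infinite (univ M)" and "simple L M"
  shows "rosy Leq Meq"
  unfolding rosy_def
proof (intro allI impI notI)
  fix X Y Z :: "((nat + ('f, 'r, 'e) eq_elem) \<times> ('f, 'r) eq_sort) set" and \<Delta> \<Gamma> k A p
  assume *: "finite X \<and> finite Y \<and> X \<inter> Y = {} \<and> Y \<inter> Z = {}
    \<and> finite \<Delta> \<and> \<Delta> \<subseteq> Form Leq (X \<union> Y) \<and> finite \<Gamma> \<and> \<Gamma> \<subseteq> Form Leq (Y \<union> Z)
    \<and> small Meq A \<and> p \<subseteq> PForm Leq Meq A X \<and> p \<noteq> {} \<and> consistent Meq X p"
    and inf_rank: "thorn_rank_type Meq X Y Z \<Delta> \<Gamma> k p = \<infinity>"
  \<comment> \<open>The rank of a type is a minimum over its members, so every member of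
    \<open>p\<close> has infinite rank.\<close>
  then obtain \<phi> where "\<phi> \<in> p" by blast
  then have "thorn_rank_type Meq X Y Z \<Delta> \<Gamma> k p \<le> thorn_rank Meq X Y Z \<Delta> \<Gamma> k \<phi>"
    unfolding thorn_rank_type_def by (rule INF_lower)
  then have "thorn_rank Meq X Y Z \<Delta> \<Gamma> k \<phi> = \<infinity>" using inf_rank by simp
  moreover have "finite \<Delta>" using * by blast
  ultimately obtain \<delta> where \<delta>: "\<delta> \<in> \<Delta>" "\<And>n. deep_tree (\<lambda>b a. holds Meq b (inst a \<delta>))
      (tuples Meq X) (tuples Meq Y) k n (\<lambda>b. holds Meq b \<phi>)"
    using infinite_thorn_rank_imp_deep_trees by blast
  have "finite X" "finite Y" "X \<inter> Y = {}" "\<delta> \<in> Form Leq (X \<union> Y)" using * \<delta>(1) by blast+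
  from eq_deep_trees_transfer[OF this \<delta>(2)] obtain X' Y' :: "(nat \<times> unit) set" and \<delta>' where
    "finite X'" "finite Y'" "X' \<inter> Y' = {}" "\<delta>' \<in> Form L (X' \<union> Y')"
    "\<And>n. deep_tree (\<lambda>b a. holds M b (inst a \<delta>')) (tuples M X') (tuples M Y') k n (\<lambda>_. True)"
    by blast
  then show False
    using deep_trees_imp_tree_property[OF sat inf, of X' Y' \<delta>' k] assms(3) unfolding simple_def by blast
qed

end

theorem mainTheorem5:
  fixes L :: "(unit, 'f, 'r) lang"
    and T :: "(nat, unit, 'f, 'r) fm set"
    and M :: "(unit, 'f, 'r, 'e) struct"
  assumes "wf_lang L"
    and "complete_theory TYPE('e) L T"
    and "monster L T M"
    and "simple L M"
  shows "rosy (eq_lang L M) (eq_struct L M)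
    \<and> (\<forall>A B C. small (eq_struct L M) A \<and> small (eq_struct L M) B \<and> small (eq_struct L M) C
          \<and> fork_indep (eq_lang L M) (eq_struct L M) A C B
        \<longrightarrow> thorn_indep (eq_lang L M) (eq_struct L M) A C B)"
proof -
  have "Sorts L = UNIV" using assms(1) by (auto simp: wf_lang_def)
  moreover have "is_struct L M" using assms(3) by (simp add: monster_def models_def)
  ultimately interpret one_sorted_struct L M by unfold_locales
  have "(UNIV :: nat set) \<lesssim> univ M" using assms(3) by (simp add: monster_def lesspoll_def)
  then have "infinite (univ M)" by (simp add: infinite_le_lepoll)
  moreover have "saturated L M" using assms(3) by (simp add: monster_def)
  ultimately have "rosy (eq_lang L M) (eq_struct L M)" using simple_imp_eq_rosy assms(4) by blast
  then show ?thesis using fork_indep_imp_thorn_indep by blast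
qed

end
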